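(* Let $\mathbf\Psi=(\Psi^0,\Psi^1,\Psi^2)^{T}$, where $\Psi^0,\Psi^1,\Psi^2$ are formal series of the form $$\Psi^0=\lambda+\sum_{n=1}^\infty \Psi^0_n(\mathbf t^1,\mathbf t^2)\lambda^{-n},\qquad \Psi^k=\sum_{n=0}^\infty t^k_n(\Psi^0)^n+\sum_{n=1}^\infty\Psi^k_n(\mathbf t^1,\mathbf t^2)(\Psi^0)^{-n}\quad(k=1,2),$$ depending on the times $\mathbf t^1=(t^1_0,\dots,t^1_n,\dots)$, $\mathbf t^2=(t^2_0,\dots,t^2_n,\dots)$. Denote $x=t^1_0$, $y=t^2_0$, $\partial^1_n=\partial/\partial t^1_n$, $\partial^2_n=\partial/\partial t^2_n$, $\partial_0=\partial_\lambda$, $\partial_1=\partial_x$, $\partial_2=\partial_y$, and $$J=\begin{pmatrix}\Psi^0_\lambda&\Psi^1_\lambda&\Psi^2_\lambda\\ \Psi^0_x&\Psi^1_x&\Psi^2_x\\ \Psi^0_y&\Psi^1_y&\Psi^2_y\end{pmatrix}.$$ Then the flows $$\partial^1_n\mathbf\Psi=\sum_{i=0,1,2}\big(J^{-1}_{1i}(\Psi^0)^n\big)_+\,\partial_i\mathbf\Psi,\qquad \partial^2_n\mathbf\Psi=\sum_{i=0,1,2}\big(J^{-1}_{2i}(\Psi^0)^n\big)_+\,\partial_i\mathbf\Psi\qquad(n\ge0)$$ commute, and the condition $\det J=1$ is preserved by the dynamics.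
   Context: Projector: $\big(\sum_{n=-\infty}^{\infty}u_n\lambda^n\big)_+=\sum_{n=0}^{\infty}u_n\lambda^n$. Subscripts $\lambda,x,y$ denote partial derivatives. $J^{-1}_{ai}$ is the entry of the inverse matrix $J^{-1}$ in row $a$ and column $i$, rows and columns being indexed by $0,1,2$. Writing the flows as $\partial^a_n\mathbf\Psi=\hat V^a_{n+}\mathbf\Psi$ with the vector fields $\hat V^a_{n+}=\sum_{i=0,1,2}\big(J^{-1}_{ai}(\Psi^0)^n\big)_+\partial_i$, $a=1,2$, commutativity of the flows means the compatibility condition $\partial^b_m(\hat V^a_{n+}\mathbf\Psi)=\partial^a_n(\hat V^b_{m+}\mathbf\Psi)$ for any two flows, the time derivatives being taken by virtue of the flow equations. *)

theory Defs
  imports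
    "HOL-Analysis.Analysis"
    "HOL-Computational_Algebra.Formal_Laurent_Series"
    "HOL-Library.Multiset"
begin

section \<open>Formal power series in arbitrarily many commuting variables\<close>

text \<open>
  A monomial in the variables \<open>'v\<close> is a finite multiset of variables; a formal power series is an
  arbitrary family of coefficients indexed by the monomials.
\<close>

typedef ('v, 'a) mfps = "UNIV :: ('v multiset \<Rightarrow> 'a) set"
  morphisms mcoeff Abs_mfps
  by simp

setup_lifting type_definition_mfps

lemma mfps_eqI: "(\<And>m. mcoeff f m = mcoeff g m) \<Longrightarrow> f = g"
  by transfer auto

lemma finite_submultisets: "finite {p. p \<subseteq># (m :: 'v multiset)}"
proof (induction m)
  case empty
  then show ?case by simp
next
  case (add x m)
  have "{p. p \<subseteq># add_mset x m} \<subseteq> {p. p \<subseteq># m} \<union> add_mset x ` {p. p \<subseteq># m}"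
  proof
    fix p assume "p \<in> {p. p \<subseteq># add_mset x m}"
    then have p: "p \<subseteq># add_mset x m" by simp
    show "p \<in> {p. p \<subseteq># m} \<union> add_mset x ` {p. p \<subseteq># m}"
    proof (cases "x \<in># p")
      case True
      then obtain q where "p = add_mset x q" by (meson multi_member_split)
      with p show ?thesis by auto
    next
      case False
      with p have "p \<subseteq># m"
        by (metis diff_single_trivial subset_eq_diff_conv add_mset_add_single)
      then show ?thesis by simp
    qed
  qed
  with add.IH show ?case by (meson finite_UnI finite_imageI finite_subset)
qed

instantiation mfps :: (type, comm_ring_1) comm_ring_1
begin

lift_definition zero_mfps :: "('a, 'b) mfps" is "\<lambda>_. 0" .
lift_definition one_mfps :: "('a, 'b) mfps" is "\<lambda>m. if m = {#} then 1 else 0" .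
lift_definition plus_mfps :: "('a, 'b) mfps \<Rightarrow> ('a, 'b) mfps \<Rightarrow> ('a, 'b) mfps"
  is "\<lambda>f g m. f m + g m" .
lift_definition minus_mfps :: "('a, 'b) mfps \<Rightarrow> ('a, 'b) mfps \<Rightarrow> ('a, 'b) mfps"
  is "\<lambda>f g m. f m - g m" .
lift_definition uminus_mfps :: "('a, 'b) mfps \<Rightarrow> ('a, 'b) mfps"
  is "\<lambda>f m. - f m" .
lift_definition times_mfps :: "('a, 'b) mfps \<Rightarrow> ('a, 'b) mfps \<Rightarrow> ('a, 'b) mfps"
  is "\<lambda>f g m. \<Sum>p | p \<subseteq># m. f p * g (m - p)" .

instance
proof
  fix a b c :: "('a, 'b) mfps"
  show "a * b * c = a * (b * c)"
  proof (transfer, rule ext)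
    fix a b c :: "'a multiset \<Rightarrow> 'b" and m :: "'a multiset"
    have "(\<Sum>p | p \<subseteq># m. (\<Sum>q | q \<subseteq># p. a q * b (p - q)) * c (m - p)) =
          (\<Sum>(p, q) \<in> Sigma {p. p \<subseteq># m} (\<lambda>p. {q. q \<subseteq># p}). a q * b (p - q) * c (m - p))"
      by (simp add: sum.Sigma finite_submultisets sum_distrib_right)
    also have "\<dots> = (\<Sum>(q, r) \<in> Sigma {q. q \<subseteq># m} (\<lambda>q. {r. r \<subseteq># m - q}).
                     a q * b r * c (m - q - r))"
    proof (rule sum.reindex_bij_witness
        [where i = "\<lambda>(q, r). (q + r, q)" and j = "\<lambda>(p, q). (q, p - q)"], goal_cases)
      case (2 x)
      then show ?case
        by (auto simp: subseteq_mset_def intro!: diff_le_mono intro: order_trans)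
    next
      case (4 x)
      then show ?case
        by (auto simp: subset_mset.le_diff_conv2 union_commute)
    next
      case (5 x)
      then show ?case by auto
    qed auto
    also have "\<dots> = (\<Sum>q | q \<subseteq># m. a q * (\<Sum>r | r \<subseteq># m - q. b r * c (m - q - r)))"
      by (simp add: sum.Sigma finite_submultisets sum_distrib_left mult.assoc)
    finally show "(\<Sum>p | p \<subseteq># m. (\<Sum>q | q \<subseteq># p. a q * b (p - q)) * c (m - p)) =
      (\<Sum>q | q \<subseteq># m. a q * (\<Sum>r | r \<subseteq># m - q. b r * c (m - q - r)))" .
  qed
  show "a * b = b * a"
  proof (transfer, rule ext)
    fix a b :: "'a multiset \<Rightarrow> 'b" and m :: "'a multiset"
    show "(\<Sum>p | p \<subseteq># m. a p * b (m - p)) = (\<Sum>p | p \<subseteq># m. b p * a (m - p))"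
      by (rule sum.reindex_bij_witness[where i = "\<lambda>p. m - p" and j = "\<lambda>p. m - p"])
         (auto simp: mult.commute subset_mset.diff_diff_right)
  qed
  show "1 * a = a"
  proof (transfer, rule ext)
    fix a :: "'a multiset \<Rightarrow> 'b" and m :: "'a multiset"
    have "(\<Sum>p | p \<subseteq># m. (if p = {#} then 1 else 0) * a (m - p)) =
          (\<Sum>p | p \<subseteq># m. if p = {#} then a m else 0)"
      by (rule sum.cong) auto
    then show "(\<Sum>p | p \<subseteq># m. (if p = {#} then 1 else 0) * a (m - p)) = a m"
      by (simp add: sum.delta finite_submultisets)
  qed
  show "(a + b) * c = a * c + b * c"
    by transfer (auto simp: distrib_right sum.distrib)
  show "a + b + c = a + (b + c)" "a + b = b + a"
    by (transfer; auto simp: algebra_simps)+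
  show "0 + a = a" "- a + a = 0" "a - b = a + - b"
    by (transfer; auto)+
  show "(0 :: ('a, 'b) mfps) \<noteq> 1"
    by transfer (metis zero_neq_one)
qed

end

lift_definition mfps_const :: "'a::zero \<Rightarrow> ('v, 'a) mfps"
  is "\<lambda>c m. if m = {#} then c else 0" .

lift_definition mfps_var :: "'v \<Rightarrow> ('v, 'a::{zero,one}) mfps"
  is "\<lambda>v m. if m = {#v#} then 1 else 0" .

lift_definition mfps_map :: "('a \<Rightarrow> 'b) \<Rightarrow> ('v, 'a) mfps \<Rightarrow> ('v, 'b) mfps"
  is "\<lambda>h f m. h (f m)" .

lift_definition mfps_deriv :: "'v \<Rightarrow> ('v, 'a::semiring_1) mfps \<Rightarrow> ('v, 'a) mfps"
  is "\<lambda>v f m. of_nat (Suc (count m v)) * f (add_mset v m)" .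

lift_definition mfps_at_zero :: "'v set \<Rightarrow> ('v, 'a::zero) mfps \<Rightarrow> ('v, 'a) mfps"
  is "\<lambda>S f m. if set_mset m \<inter> S = {} then f m else 0" .

text \<open>Multiplicative inverse; meaningful for units only.\<close>

definition mfps_inv :: "('v, 'a::comm_ring_1) mfps \<Rightarrow> ('v, 'a) mfps" where
  "mfps_inv f = (THE g. f * g = 1)"


section \<open>Series in the spectral parameter\<close>

text \<open>
  A Laurent series in \<open>\<lambda>\<^sup>-\<^sup>1\<close> over \<open>'a\<close> is an element of \<^typ>\<open>'a fls\<close> whose indeterminate
  \<^const>\<open>fls_X\<close> stands for \<open>\<lambda>\<^sup>-\<^sup>1\<close>. So \<^const>\<open>fls_X_inv\<close> is \<open>\<lambda>\<close>, the coefficient at \<open>\<lambda>\<^sup>n\<close> sits at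
  index \<open>-n\<close>, and \<open>\<partial>\<^sub>\<lambda> = - X\<^sup>2 d/dX\<close>.
\<close>

definition lambda_deriv :: "'a::comm_ring_1 fls \<Rightarrow> 'a fls" where
  "lambda_deriv u = - (fls_X ^ 2 * fls_deriv u)"

definition lambda_pos :: "'a::zero fls \<Rightarrow> 'a fls" where
  "lambda_pos u = Abs_fls (\<lambda>j. if j \<le> 0 then fls_nth u j else 0)"

lemma lambda_deriv_nth:
  "fls_nth (lambda_deriv u) (- n) = of_int (n + 1) * fls_nth u (- (n + 1))"
proof -
  have "fls_nth (fls_X ^ 2 * fls_deriv u) (- n) = of_int (- (n + 1)) * fls_nth u (- (n + 1))"
    by (simp add: fls_X_power_times_conv_shift algebra_simps)
  then show ?thesis
    by (simp only: lambda_deriv_def fls_uminus_nth of_int_minus mult_minus_left minus_minus)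
qed

lemma lambda_pos_nth: "fls_nth (lambda_pos u) (- n) = (if n \<ge> 0 then fls_nth u (- n) else 0)"
proof -
  have "\<forall>j < min 0 (fls_subdegree u). (if j \<le> 0 then fls_nth u j else 0) = 0"
    by simp
  from nth_Abs_fls_lower_bound[OF this] show ?thesis
    by (simp add: lambda_pos_def)
qed

text \<open>
  The variables are the times \<open>t\<^sup>1\<^sub>n\<close>, \<open>t\<^sup>2\<^sub>n\<close> and one auxiliary variable, used only to form
  variational derivatives.

  The two-sided infinite series of the hierarchy live in the ring of formal power series in the
  variables whose coefficients are Laurent series in \<open>\<lambda>\<^sup>-\<^sup>1\<close>: at every fixed monomial in the times
  only finitely many positive powers of \<open>\<lambda>\<close> occur, which is what makes products of such series
  (and the inverse of the Jacobi matrix) well defined.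
\<close>

datatype var = T1 nat | T2 nat | Eps

type_synonym 'a ser = "(var, 'a fls) mfps"

definition time :: "3 \<Rightarrow> nat \<Rightarrow> var" where
  "time a n = (if a = 1 then T1 n else T2 n)"

text \<open>Coefficient functions: formal power series in the times alone.\<close>

definition eps_free :: "(var, 'a::zero) mfps \<Rightarrow> bool" where
  "eps_free f \<longleftrightarrow> (\<forall>m. Eps \<in># m \<longrightarrow> mcoeff f m = 0)"

abbreviation coef :: "(var, 'a::zero) mfps \<Rightarrow> 'a ser" where
  "coef \<equiv> mfps_map fls_const"

text \<open>
  Convergence of formal series: at every monomial, in the \<open>\<lambda>\<^sup>-\<^sup>1\<close>-adic topology of \<^typ>\<open>'a fls\<close>.
\<close>

definition ser_sums :: "(nat \<Rightarrow> 'a::comm_ring_1 ser) \<Rightarrow> 'a ser \<Rightarrow> bool"  (infixr \<open>ser'_sums\<close> 80)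
  where "f ser_sums s \<longleftrightarrow> (\<forall>m. (\<lambda>n. mcoeff (f n) m) sums mcoeff s m)"


section \<open>The hierarchy\<close>

text \<open>
  Triples and the rows and columns of the Jacobi matrix are indexed by the elements \<open>0, 1, 2\<close> of
  type \<^typ>\<open>3\<close>.
\<close>

definition hierarchy_series :: "'a::field_char_0 ser ^ 3 \<Rightarrow> bool" where
  "hierarchy_series \<Psi> \<longleftrightarrow>
     (\<exists>\<psi> :: 3 \<Rightarrow> nat \<Rightarrow> (var, 'a) mfps.
        (\<forall>k n. eps_free (\<psi> k n)) \<and>
        (\<exists>N. (\<lambda>n. coef (\<psi> 0 (Suc n)) * mfps_const (fls_X ^ Suc n)) ser_sums N \<and>
             \<Psi> $ 0 = mfps_const fls_X_inv + N) \<and>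
        (\<forall>k \<in> {1, 2}. \<exists>P N.
             (\<lambda>n. mfps_var (time k n) * (\<Psi> $ 0) ^ n) ser_sums P \<and>
             (\<lambda>n. coef (\<psi> k (Suc n)) * mfps_inv (\<Psi> $ 0) ^ Suc n) ser_sums N \<and>
             \<Psi> $ k = P + N))"

definition pd :: "3 \<Rightarrow> 'a::comm_ring_1 ser \<Rightarrow> 'a ser" where
  "pd i = (if i = 0 then mfps_map lambda_deriv
           else if i = 1 then mfps_deriv (time 1 0)
           else mfps_deriv (time 2 0))"

definition proj_pos :: "'a::zero ser \<Rightarrow> 'a ser" where
  "proj_pos = mfps_map lambda_pos"

definition Jac :: "'a::comm_ring_1 ser ^ 3 \<Rightarrow> 'a ser ^ 3 ^ 3" where
  "Jac \<Psi> = (\<chi> i k. pd i (\<Psi> $ k))"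

definition V_pos :: "3 \<Rightarrow> nat \<Rightarrow> 'a::comm_ring_1 ser ^ 3 \<Rightarrow> 3 \<Rightarrow> 'a ser" where
  "V_pos a n \<Psi> i = proj_pos (matrix_inv (Jac \<Psi>) $ a $ i * (\<Psi> $ 0) ^ n)"

definition flow :: "3 \<Rightarrow> nat \<Rightarrow> 'a::comm_ring_1 ser ^ 3 \<Rightarrow> 'a ser ^ 3" where
  "flow a n \<Psi> = (\<chi> k. \<Sum>i\<in>UNIV. V_pos a n \<Psi> i * pd i (\<Psi> $ k))"

text \<open>
  Time derivative of an expression \<open>F(\<Psi>)\<close> by virtue of an evolution equation
  \<open>\<partial>\<Psi> = \<Phi>\<close>: the coefficient of \<open>\<epsilon>\<close> in \<open>F(\<Psi> + \<epsilon> \<Phi>)\<close>. The triple \<open>\<Psi>\<close> itself need not solve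
  the equation. The whole rate \<open>\<Phi>\<close> of \<open>\<Psi>\<close> enters, including the part due to the times occurring
  explicitly in \<open>\<Psi>\<^sup>1\<close>, \<open>\<Psi>\<^sup>2\<close>.
\<close>

definition variation ::
    "('a::comm_ring_1 ser ^ 3 \<Rightarrow> 'a ser) \<Rightarrow> 'a ser ^ 3 \<Rightarrow> 'a ser ^ 3 \<Rightarrow> 'a ser" where
  "variation F \<Psi> \<Phi> =
     mfps_at_zero {Eps} (mfps_deriv Eps (F (\<chi> k. \<Psi> $ k + mfps_var Eps * \<Phi> $ k)))"

definition time_deriv ::
    "3 \<Rightarrow> nat \<Rightarrow> ('a::comm_ring_1 ser ^ 3 \<Rightarrow> 'a ser) \<Rightarrow> 'a ser ^ 3 \<Rightarrow> 'a ser" where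
  "time_deriv a n F \<Psi> = variation F \<Psi> (flow a n \<Psi>)"

definition solves_flow :: "3 \<Rightarrow> nat \<Rightarrow> 'a::comm_ring_1 ser ^ 3 \<Rightarrow> bool" where
  "solves_flow a n \<Psi> \<longleftrightarrow> (\<forall>k. mfps_deriv (time a n) (\<Psi> $ k) = flow a n \<Psi> $ k)"

end

theory Submission
  imports Defs
begin

text \<open>
  Let \<open>W\<^sub>a = \<Sum>\<^sub>i J\<^sup>-\<^sup>1\<^sub>a\<^sub>i \<partial>\<^sub>i\<close> be the coordinate fields dual to \<open>\<Psi>\<close> (so \<open>W\<^sub>a \<Psi>\<^sup>k = \<delta>\<^sub>a\<^sub>k\<close>); the flows are the
  projections \<open>V\<^sub>+\<close> of \<open>V = (\<Psi>\<^sup>0)\<^sup>n W\<^sub>a\<close>, \<open>a = 1, 2\<close>. Since \<open>\<Psi>\<^sup>0\<close> is constant along all these \<open>V\<close>, they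
  commute. Differentiating \<open>V \<Psi>\<^sup>k = \<delta>\<^sub>a\<^sub>k (\<Psi>\<^sup>0)\<^sup>n\<close> along the flow of another such field \<open>U\<close> gives the Lax
  equation \<open>V' = [U\<^sub>+, V]\<close>, and commutativity of the flows follows by projecting \<open>[U, V] = 0\<close>. For the
  determinant \<open>d\<close> of \<open>J\<close> one finds \<open>d' = V\<^sub>+ d + (div V)\<^sub>+ d\<close> and \<open>V d = - (div V) d\<close>, a homogeneous
  linear equation for \<open>d - 1\<close>.
\<close>

no_notation fps_nth (infixl \<open>$\<close> 75)

section \<open>Twisted derivations\<close>

text \<open>
  The polynomial identity behind Jacobi's formula, for the matrix with rows \<open>(a, b, c)\<close>, \<open>(d, e, f)\<close>,
  \<open>(g, h, i)\<close> multiplied from the left by the matrix with rows \<open>(p, q, r)\<close>, \<open>(s, t, u)\<close>, \<open>(y, w, x)\<close>.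
\<close>

lemma jacobi_identity_3:
  fixes a b c d e f g h i p q r s t u y w x :: "'r::comm_ring_1"
  shows "((p*a+q*d+r*g) * e + a * (s*b+t*e+u*h)) * i + a*e*(y * c+w*f+x*i)
    + (((p*b+q*e+r*h) * f + b * (s*c+t*f+u*i)) * g + b*f*(y * a+w*d+x*g))
    + (((p*c+q*f+r*i) * d + c * (s*a+t*d+u*g)) * h + c*d*(y * b+w*e+x*h))
    - (((p*a+q*d+r*g) * f + a * (s*c+t*f+u*i)) * h + a*f*(y * b+w*e+x*h))
    - (((p*b+q*e+r*h) * d + b * (s*a+t*d+u*g)) * i + b*d*(y * c+w*f+x*i))
    - (((p*c+q*f+r*i) * e + c * (s*b+t*e+u*h)) * g + c*e*(y * a+w*d+x*g))
   = (p+t+x) * (a*e*i + b*f*g + c*d*h - a*f*h - b*d*i - c*e*g)"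
  by (simp add: algebra_simps)

text \<open>
  The two cases of interest are \<open>E = id\<close> (an ordinary derivation) and \<open>E\<close> = evaluation at
  \<open>\<epsilon> = 0\<close>, \<open>D\<close> = the coefficient of \<open>\<epsilon>\<close>.
\<close>

locale twisted_derivation =
  fixes E D :: "'r::comm_ring_1 \<Rightarrow> 'r"
  assumes E_one: "E 1 = 1"
    and E_add: "E (f + g) = E f + E g"
    and E_mult: "E (f * g) = E f * E g"
    and D_add: "D (f + g) = D f + D g"
    and D_mult: "D (f * g) = D f * E g + E f * D g"
begin

lemma E_zero: "E 0 = 0" and D_zero: "D 0 = 0"
  using E_add[of 0 0] D_add[of 0 0] by simp_all

lemma E_minus: "E (- f) = - E f" and D_minus: "D (- f) = - D f"
  using E_add[of f "- f"] D_add[of f "- f"]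
  by (simp_all add: E_zero D_zero eq_neg_iff_add_eq_0 add.commute)

lemma E_diff: "E (f - g) = E f - E g" and D_diff: "D (f - g) = D f - D g"
  by (simp_all only: diff_conv_add_uminus E_add D_add E_minus D_minus)

lemma D_one: "D 1 = 0"
  using D_mult[of 1 1] by (simp add: E_one)

lemma E_sum: "E (sum f A) = (\<Sum>x\<in>A. E (f x))"
  by (induction A rule: infinite_finite_induct) (simp_all add: E_zero E_add)

lemma D_sum: "D (sum f A) = (\<Sum>x\<in>A. D (f x))"
  by (induction A rule: infinite_finite_induct) (simp_all add: D_zero D_add)

lemma E_power: "E (f ^ n) = E f ^ n"
  by (induction n) (simp_all add: E_one E_mult)

lemma D_power: "D (f ^ n) = of_nat n * E f ^ (n - 1) * D f"
proof (induction n)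
  case (Suc n)
  have "D (f ^ Suc n) = D f * E f ^ n + of_nat n * (E f * E f ^ (n - 1)) * D f"
    by (simp add: D_mult Suc E_power mult_ac)
  also have "of_nat n * (E f * E f ^ (n - 1)) = of_nat n * E f ^ n"
    by (cases n) simp_all
  finally show ?case by (simp add: algebra_simps)
qed (simp add: D_one)

lemma E_det:
  fixes A :: "'r ^ 3 ^ 3"
  shows "E (det A) = det (\<chi> i k. E (A $ i $ k))"
  by (simp add: det_3 E_add E_diff E_mult)

text \<open>The derivation mixes the rows of the matrix through \<open>N\<close>; after expanding
  the determinant all off-diagonal entries of \<open>N\<close> cancel. In the applications
  \<open>N\<close> comes from commutators of vector fields with \<open>pd i\<close>.\<close>

lemma D_det:
  fixes A :: "'r ^ 3 ^ 3"
  assumes "\<And>i k. D (A $ i $ k) = (\<Sum>j\<in>UNIV. N i j * E (A $ j $ k))"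
  shows "D (det A) = (\<Sum>i\<in>UNIV. N i i) * E (det A)"
  unfolding det_3 D_add D_diff D_mult E_add E_diff E_mult assms sum_3
  by (rule jacobi_identity_3)

end

section \<open>Invertibility of 3 x 3 matrices over a commutative ring\<close>

lemma invertible_if_det_unit_3:
  fixes A :: "'r::comm_ring_1 ^ 3 ^ 3"
  assumes "det A * u = 1"
  shows "invertible A"
proof -
  define a where "a i j = A $ i $ j" for i j
  \<comment> \<open>The adjugate of \<open>A\<close>. The numeral 3 in type \<open>3\<close> is the
    index 0, so rows and columns run in the order 1, 2, 0.\<close>
  define C :: "'r ^ 3 ^ 3" where
    "C = vector
       [vector [a 2 2 * a 3 3 - a 2 3 * a 3 2, a 1 3 * a 3 2 - a 1 2 * a 3 3, a 1 2 * a 2 3 - a 1 3 * a 2 2],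
        vector [a 2 3 * a 3 1 - a 2 1 * a 3 3, a 1 1 * a 3 3 - a 1 3 * a 3 1, a 1 3 * a 2 1 - a 1 1 * a 2 3],
        vector [a 2 1 * a 3 2 - a 2 2 * a 3 1, a 1 2 * a 3 1 - a 1 1 * a 3 2, a 1 1 * a 2 2 - a 1 2 * a 2 1]]"
  define B :: "'r ^ 3 ^ 3" where "B = (\<chi> i j. C $ i $ j * u)"
  have "A ** C = mat (det A)" "C ** A = mat (det A)"
    unfolding vec_eq_iff matrix_matrix_mult_def sum_3 mat_def forall_3 det_3 C_def a_def
    by (simp_all only: vec_lambda_beta vector_3) (simp_all add: algebra_simps)
  then have AC: "(\<Sum>k\<in>UNIV. A$i$k * C$k$j) = (if i = j then det A else 0)"
    and CA: "(\<Sum>k\<in>UNIV. C$i$k * A$k$j) = (if i = j then det A else 0)" for i j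
    by (auto simp: vec_eq_iff matrix_matrix_mult_def mat_def)
  have "(\<Sum>k\<in>UNIV. A$i$k * B$k$j) = (\<Sum>k\<in>UNIV. A$i$k * C$k$j) * u" for i j
    by (simp add: B_def sum_distrib_left sum_distrib_right mult_ac)
  moreover have "(\<Sum>k\<in>UNIV. B$i$k * A$k$j) = (\<Sum>k\<in>UNIV. C$i$k * A$k$j) * u" for i j
    by (simp add: B_def sum_distrib_left sum_distrib_right mult_ac)
  ultimately have "A ** B = mat 1" "B ** A = mat 1"
    using assms by (auto simp: vec_eq_iff matrix_matrix_mult_def mat_def AC CA)
  then show ?thesis unfolding invertible_def by blast
qed

lemma matrix_inv_mult:
  assumes "invertible A"
  shows "A ** matrix_inv A = mat 1" "matrix_inv A ** A = mat 1"
  using someI_ex[OF assms[unfolded invertible_def]] by (simp_all add: matrix_inv_def)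

section \<open>Formal power series in several variables\<close>

lemma mcoeff_zero [simp]: "mcoeff 0 m = 0"
  by transfer simp

lemma mcoeff_one: "mcoeff 1 m = (if m = {#} then 1 else 0)"
  by transfer simp

lemma mcoeff_add [simp]: "mcoeff (f + g) m = mcoeff f m + mcoeff g m"
  by transfer simp

lemma mcoeff_diff [simp]: "mcoeff (f - g) m = mcoeff f m - mcoeff g m"
  by transfer simp

lemma mcoeff_uminus [simp]: "mcoeff (- f) m = - mcoeff f m"
  by transfer simp

lemma mcoeff_mult: "mcoeff (f * g) m = (\<Sum>p | p \<subseteq># m. mcoeff f p * mcoeff g (m - p))"
  by transfer simp

lemma mcoeff_map [simp]: "mcoeff (mfps_map h f) m = h (mcoeff f m)"
  by transfer simp

lemma mcoeff_const: "mcoeff (mfps_const c) m = (if m = {#} then c else 0)"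
  by transfer simp

lemma mcoeff_var: "mcoeff (mfps_var v) m = (if m = {#v#} then 1 else 0)"
  by transfer simp

lemma mcoeff_deriv [simp]:
  "mcoeff (mfps_deriv v f) m = of_nat (Suc (count m v)) * mcoeff f (add_mset v m)"
  by transfer simp

lemma mcoeff_at_zero:
  "mcoeff (mfps_at_zero S f) m = (if set_mset m \<inter> S = {} then mcoeff f m else 0)"
  by transfer simp

lemma mcoeff_sum: "mcoeff (sum f A) m = (\<Sum>x\<in>A. mcoeff (f x) m)"
  by (induction A rule: infinite_finite_induct) auto

lemma mcoeff_mult_empty [simp]: "mcoeff (f * g) {#} = mcoeff f {#} * mcoeff g {#}"
  by (simp add: mcoeff_mult)

lemma mcoeff_power_empty [simp]: "mcoeff (f ^ n) {#} = mcoeff f {#} ^ n"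
  by (induction n) (simp_all add: mcoeff_one)

lemma mfps_deriv_add: "mfps_deriv v (f + g) = mfps_deriv v f + mfps_deriv v g"
  by (rule mfps_eqI) (simp add: algebra_simps)

text \<open>For each splitting of \<open>add_mset v m\<close> into two factors, the multiplicity of
  \<open>v\<close> is the sum of its multiplicities in the factors; each of these gives one term of
  the Leibniz rule.\<close>

lemma mfps_deriv_mult:
  fixes f g :: "('v, 'a::comm_ring_1) mfps"
  shows "mfps_deriv v (f * g) = mfps_deriv v f * g + f * mfps_deriv v g"
proof (rule mfps_eqI)
  fix m :: "'v multiset"
  define A where "A = {p. p \<subseteq># add_mset v m}"
  have fin: "finite A" unfolding A_def by (rule finite_submultisets)
  \<comment> \<open>The weight kills the submultisets without \<open>v\<close>; removing one
    \<open>v\<close> from each of the others leaves a convolution over \<open>m\<close>.\<close>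
  have half: "(\<Sum>p\<in>A. of_nat (count p v) * (mcoeff f p * mcoeff g (add_mset v m - p))) =
       mcoeff (mfps_deriv v f * g) m" for f g :: "('v, 'a) mfps"
  proof -
    have "(\<Sum>p\<in>A. of_nat (count p v) * (mcoeff f p * mcoeff g (add_mset v m - p))) =
       (\<Sum>p\<in>{p\<in>A. v \<in># p}. of_nat (count p v) * (mcoeff f p * mcoeff g (add_mset v m - p)))"
      using fin by (intro sum.mono_neutral_right) (auto simp: not_in_iff)
    also have "\<dots> = (\<Sum>q | q \<subseteq># m. of_nat (Suc (count q v)) * mcoeff f (add_mset v q) * mcoeff g (m - q))"
      by (rule sum.reindex_bij_witness[where i = "add_mset v" and j = "\<lambda>p. p - {#v#}"])
         (auto simp: A_def insert_subset_eq_iff algebra_simps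
               dest!: multi_member_split)
    finally show ?thesis by (simp add: mcoeff_mult)
  qed
  have "mcoeff (mfps_deriv v (f * g)) m =
     (\<Sum>p\<in>A. of_nat (Suc (count m v)) * (mcoeff f p * mcoeff g (add_mset v m - p)))"
    by (simp only: mcoeff_deriv mcoeff_mult sum_distrib_left A_def)
  also have "\<dots> = (\<Sum>p\<in>A. of_nat (count p v) * (mcoeff f p * mcoeff g (add_mset v m - p))) +
      (\<Sum>p\<in>A. of_nat (count (add_mset v m - p) v) * (mcoeff f p * mcoeff g (add_mset v m - p)))"
    unfolding sum.distrib[symmetric]
  proof (rule sum.cong)
    fix p assume "p \<in> A"
    then have "count p v \<le> Suc (count m v)"
      unfolding A_def using mset_subset_eq_count[of p "add_mset v m" v] by simp
    then have "Suc (count m v) = count p v + count (add_mset v m - p) v" by simp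
    then show "of_nat (Suc (count m v)) * (mcoeff f p * mcoeff g (add_mset v m - p)) =
       of_nat (count p v) * (mcoeff f p * mcoeff g (add_mset v m - p)) +
       of_nat (count (add_mset v m - p) v) * (mcoeff f p * mcoeff g (add_mset v m - p))"
      by (simp only: of_nat_add distrib_right)
  qed simp
  also have "(\<Sum>p\<in>A. of_nat (count (add_mset v m - p) v) * (mcoeff f p * mcoeff g (add_mset v m - p))) =
      (\<Sum>p\<in>A. of_nat (count p v) * (mcoeff g p * mcoeff f (add_mset v m - p)))"
    by (rule sum.reindex_bij_witness[where i = "\<lambda>p. add_mset v m - p" and j = "\<lambda>p. add_mset v m - p"])
       (auto simp: A_def subset_mset.diff_diff_right mult.commute)
  finally show "mcoeff (mfps_deriv v (f * g)) m = mcoeff (mfps_deriv v f * g + f * mfps_deriv v g) m"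
    by (simp only: half mcoeff_add) (simp add: mult.commute)
qed

lemma mfps_deriv_commute:
  fixes f :: "('v, 'a::comm_ring_1) mfps"
  shows "mfps_deriv u (mfps_deriv v f) = mfps_deriv v (mfps_deriv u f)"
  by (rule mfps_eqI) (simp add: add_mset_commute mult_ac)

text \<open>A product of monomials avoids the variables in \<open>S\<close> exactly when both
  factors do.\<close>

lemma mfps_at_zero_mult:
  fixes f g :: "('v, 'a::comm_ring_1) mfps"
  shows "mfps_at_zero S (f * g) = mfps_at_zero S f * mfps_at_zero S g"
proof (rule mfps_eqI)
  fix m :: "'v multiset"
  have "set_mset m \<inter> S = {} \<longleftrightarrow> set_mset p \<inter> S = {} \<and> set_mset (m - p) \<inter> S = {}"
    if "p \<subseteq># m" for p
    using arg_cong[OF subset_mset.add_diff_inverse[OF that], of set_mset] by auto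
  then have "mcoeff (mfps_at_zero S f) p * mcoeff (mfps_at_zero S g) (m - p) =
     (if set_mset m \<inter> S = {} then mcoeff f p * mcoeff g (m - p) else 0)" if "p \<subseteq># m" for p
    using that by (auto simp: mcoeff_at_zero)
  then show "mcoeff (mfps_at_zero S (f * g)) m = mcoeff (mfps_at_zero S f * mfps_at_zero S g) m"
    by (simp add: mcoeff_mult) (simp add: mcoeff_at_zero mcoeff_mult)
qed

lemma twisted_derivation_mfps_deriv:
  "twisted_derivation (\<lambda>f. f) (mfps_deriv v :: ('v, 'a::comm_ring_1) mfps \<Rightarrow> _)"
  by unfold_locales (simp_all add: mfps_deriv_add mfps_deriv_mult)

lemma twisted_derivation_at_zero:
  "twisted_derivation (mfps_at_zero S) (\<lambda>f :: ('v, 'a::comm_ring_1) mfps. mfps_at_zero S (mfps_deriv v f))"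
proof
  show add: "mfps_at_zero S (f + g) = mfps_at_zero S f + mfps_at_zero S g" for f g :: "('v, 'a) mfps"
    by (rule mfps_eqI) (simp add: mcoeff_at_zero)
  show "mfps_at_zero S (1 :: ('v, 'a) mfps) = 1"
    by (rule mfps_eqI) (simp add: mcoeff_at_zero mcoeff_one)
  show "mfps_at_zero S (mfps_deriv v (f * g)) =
      mfps_at_zero S (mfps_deriv v f) * mfps_at_zero S g +
      mfps_at_zero S f * mfps_at_zero S (mfps_deriv v g)" for f g :: "('v, 'a) mfps"
    by (simp add: mfps_deriv_mult mfps_at_zero_mult add)
qed (rule mfps_eqI, simp add: mcoeff_at_zero mcoeff_one mfps_at_zero_mult algebra_simps)+

text \<open>Comparing coefficients in \<open>f * g = 1\<close>, the recursion determines \<open>g\<close> from its constant term.\<close>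

function mfps_inv_coeff :: "('v multiset \<Rightarrow> 'a::field) \<Rightarrow> 'v multiset \<Rightarrow> 'a" where
  "mfps_inv_coeff f m =
     (if m = {#} then inverse (f {#})
      else - inverse (f {#}) * (\<Sum>p\<in>{p. p \<subseteq># m} - {{#}}. f p * mfps_inv_coeff f (m - p)))"
  by auto
termination mfps_inv_coeff
proof (relation "inv_image less_than (\<lambda>(f, m). size m)", goal_cases)
  case (2 f m p)
  then show ?case
    by (simp add: size_Diff_submset diff_less nonempty_has_size)
qed simp

declare mfps_inv_coeff.simps [simp del]

text \<open>Every coefficient of the inverse is a finite expression in coefficients of
  \<open>f\<close>, so powers of lambda may grow without bound from monomial to monomial.\<close>

lemma mfps_unit:
  fixes f :: "('v, 'a::field) mfps"
  assumes "mcoeff f {#} \<noteq> 0"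
  obtains g where "f * g = 1"
proof
  define g where "g = Abs_mfps (mfps_inv_coeff (mcoeff f))"
  have g: "mcoeff g m = mfps_inv_coeff (mcoeff f) m" for m
    by (simp add: g_def Abs_mfps_inverse)
  show "f * g = 1"
  proof (rule mfps_eqI)
    fix m :: "'v multiset"
    have "mcoeff (f * g) m = mcoeff f {#} * mcoeff g m +
        (\<Sum>p\<in>{p. p \<subseteq># m} - {{#}}. mcoeff f p * mcoeff g (m - p))"
      by (simp add: mcoeff_mult sum.remove[of _ "{#}"] finite_submultisets)
    also have "\<dots> = mcoeff 1 m"
      using assms by (simp add: g mfps_inv_coeff.simps[of _ m] mcoeff_one)
    finally show "mcoeff (f * g) m = mcoeff 1 m" .
  qed
qed

lemma mult_right_inverse_unique:
  fixes f :: "'a::comm_monoid_mult"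
  assumes "f * g = 1" "f * h = 1"
  shows "g = h"
proof -
  have "h * (f * g) = g"
    using assms(2) by (simp add: mult.left_commute flip: mult.assoc)
  then show ?thesis using assms(1) by simp
qed

lemma mult_mfps_inv:
  assumes "f * g = (1 :: ('v, 'a::comm_ring_1) mfps)"
  shows "f * mfps_inv f = 1"
  unfolding mfps_inv_def
  by (rule theI[of _ g], rule assms) (rule mult_right_inverse_unique[OF _ assms])

section \<open>The projection and the derivations\<close>

lemma nth_lambda_pos: "fls_nth (lambda_pos u) j = (if j \<le> 0 then fls_nth u j else 0)"
  using lambda_pos_nth[of u "- j"] by simp

lemma nth_lambda_deriv: "fls_nth (lambda_deriv u) j = of_int (1 - j) * fls_nth u (j - 1)"
  using lambda_deriv_nth[of u "- j"] by simp

lemma lambda_pos_eq_0_iff: "lambda_pos u = 0 \<longleftrightarrow> (\<forall>j\<le>0. fls_nth u j = 0)"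
  by (auto simp: fls_eq_iff nth_lambda_pos)

lemma lambda_pos_fixed_iff: "lambda_pos u = u \<longleftrightarrow> (\<forall>j>0. fls_nth u j = 0)"
  by (auto simp: fls_eq_iff nth_lambda_pos)

lemma lambda_pos_add: "lambda_pos (u + v) = lambda_pos u + lambda_pos (v :: 'a::comm_ring_1 fls)"
  by (simp add: fls_eq_iff nth_lambda_pos)

lemma lambda_pos_idem: "lambda_pos (lambda_pos u) = lambda_pos u"
  by (simp add: fls_eq_iff nth_lambda_pos)

text \<open>The index of a coefficient is minus the exponent of lambda. The two indices in each term
  of the product add up to \<open>j\<close>, so for \<open>j > 0\<close> one of them is
  positive.\<close>

lemma lambda_pos_mult_pos:
  fixes u v :: "'a::comm_ring_1 fls"
  assumes "lambda_pos u = u" "lambda_pos v = v"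
  shows "lambda_pos (u * v) = u * v"
  unfolding lambda_pos_fixed_iff
proof safe
  fix j :: int assume "j > 0"
  then have 0: "fls_nth u (i - s) * fls_nth v (s + j - i) = 0" for i s
    using assms unfolding lambda_pos_fixed_iff by (cases "i - s > 0") auto
  then show "fls_nth (u * v) j = 0"
    unfolding fls_times_nth(1) by (intro sum.neutral) (simp add: 0)
qed

lemma lambda_pos_mult_neg:
  fixes u v :: "'a::comm_ring_1 fls"
  assumes "lambda_pos u = 0" "lambda_pos v = 0"
  shows "lambda_pos (u * v) = 0"
  unfolding lambda_pos_eq_0_iff
proof safe
  fix j :: int assume "j \<le> 0"
  then have 0: "fls_nth u (i - s) * fls_nth v (s + j - i) = 0" for i s
    using assms unfolding lambda_pos_eq_0_iff by (cases "i - s \<le> 0") auto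
  then show "fls_nth (u * v) j = 0"
    unfolding fls_times_nth(1) by (intro sum.neutral) (simp add: 0)
qed

lemma lambda_deriv_add: "lambda_deriv (u + v) = lambda_deriv u + lambda_deriv v"
  by (simp add: lambda_deriv_def algebra_simps)

lemma lambda_deriv_mult: "lambda_deriv (u * v) = lambda_deriv u * v + u * lambda_deriv v"
  by (simp add: lambda_deriv_def algebra_simps)

text \<open>Differentiation lowers the exponent of lambda by one, so only the constant term could
  cross the cut (to index \<open>j = 1\<close>), and it is annihilated.\<close>

lemma lambda_deriv_pos: "lambda_deriv (lambda_pos u) = lambda_pos (lambda_deriv u)"
proof -
  have "(1 - of_int j) * fls_nth u (j - 1) = 0" if "j \<le> 1" "\<not> j \<le> 0" for j
  proof -
    have "j = 1" using that by simp
    then show ?thesis by simp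
  qed
  then show ?thesis by (auto simp: fls_eq_iff nth_lambda_pos nth_lambda_deriv)
qed

lemma lambda_deriv_of_nat_mult: "lambda_deriv (of_nat n * u) = of_nat n * lambda_deriv u"
  by (simp add: lambda_deriv_def mult_ac)

lemma lambda_pos_of_nat_mult:
  "lambda_pos (of_nat n * u) = of_nat n * lambda_pos (u :: 'a::comm_ring_1 fls)"
  by (simp add: fls_eq_iff nth_lambda_pos fls_mult_of_nat_nth)

lemma lambda_pos_zero [simp]: "lambda_pos 0 = 0"
  by (simp add: lambda_pos_eq_0_iff)

lemma lambda_pos_uminus: "lambda_pos (- u) = - lambda_pos (u :: 'a::comm_ring_1 fls)"
  by (simp add: fls_eq_iff nth_lambda_pos)

lemma lambda_pos_diff: "lambda_pos (u - v) = lambda_pos u - lambda_pos (v :: 'a::comm_ring_1 fls)"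
  by (simp add: fls_eq_iff nth_lambda_pos)

lemma lambda_pos_sum: "lambda_pos (sum f A) = (\<Sum>x\<in>A. lambda_pos (f x :: 'a::comm_ring_1 fls))"
  by (induction A rule: infinite_finite_induct) (simp_all add: lambda_pos_add)

lemma lambda_deriv_zero [simp]: "lambda_deriv 0 = 0"
  by (simp add: lambda_deriv_def)

lemma lambda_deriv_sum: "lambda_deriv (sum f A) = (\<Sum>x\<in>A. lambda_deriv (f x))"
  by (induction A rule: infinite_finite_induct) (simp_all add: lambda_deriv_add)

lemma proj_pos_zero [simp]: "proj_pos 0 = 0"
  by (rule mfps_eqI) (simp add: proj_pos_def)

lemma proj_pos_add: "proj_pos (f + g) = proj_pos f + proj_pos (g :: 'a::comm_ring_1 ser)"
  by (rule mfps_eqI) (simp add: proj_pos_def lambda_pos_add)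

lemma proj_pos_diff: "proj_pos (f - g) = proj_pos f - proj_pos (g :: 'a::comm_ring_1 ser)"
  by (rule mfps_eqI) (simp add: proj_pos_def lambda_pos_diff)

lemma proj_pos_sum: "proj_pos (sum f A) = (\<Sum>x\<in>A. proj_pos (f x :: 'a::comm_ring_1 ser))"
  by (induction A rule: infinite_finite_induct) (simp_all add: proj_pos_add)

lemma proj_pos_idem [simp]: "proj_pos (proj_pos f) = proj_pos f"
  by (rule mfps_eqI) (simp add: proj_pos_def lambda_pos_idem)

lemma proj_pos_mult_pos:
  fixes f g :: "'a::comm_ring_1 ser"
  assumes "proj_pos f = f" "proj_pos g = g"
  shows "proj_pos (f * g) = f * g"
proof (rule mfps_eqI)
  fix m
  have "lambda_pos (mcoeff f p) = mcoeff f p" "lambda_pos (mcoeff g p) = mcoeff g p" for p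
    using assms[THEN arg_cong[of _ _ "\<lambda>f. mcoeff f p"]] by (simp_all add: proj_pos_def)
  then show "mcoeff (proj_pos (f * g)) m = mcoeff (f * g) m"
    by (simp add: proj_pos_def mcoeff_mult lambda_pos_sum lambda_pos_mult_pos)
qed

lemma proj_pos_mult_neg:
  fixes f g :: "'a::comm_ring_1 ser"
  assumes "proj_pos f = 0" "proj_pos g = 0"
  shows "proj_pos (f * g) = 0"
proof (rule mfps_eqI)
  fix m
  have "lambda_pos (mcoeff f p) = 0" "lambda_pos (mcoeff g p) = 0" for p
    using assms[THEN arg_cong[of _ _ "\<lambda>f. mcoeff f p"]] by (simp_all add: proj_pos_def)
  then show "mcoeff (proj_pos (f * g)) m = mcoeff 0 m"
    by (simp add: proj_pos_def mcoeff_mult lambda_pos_sum lambda_pos_mult_neg)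
qed

lemma proj_pos_deriv: "proj_pos (mfps_deriv v f) = mfps_deriv v (proj_pos (f :: 'a::comm_ring_1 ser))"
  by (rule mfps_eqI) (simp add: proj_pos_def lambda_pos_of_nat_mult del: of_nat_Suc)

lemma proj_pos_at_zero: "proj_pos (mfps_at_zero S f) = mfps_at_zero S (proj_pos f)"
  by (rule mfps_eqI) (simp add: proj_pos_def mcoeff_at_zero)

lemma twisted_derivation_pd: "twisted_derivation (\<lambda>f. f) (pd i)"
proof -
  have "twisted_derivation (\<lambda>f. f) (mfps_map lambda_deriv :: 'a::comm_ring_1 ser \<Rightarrow> 'a ser)"
    by unfold_locales
      (rule mfps_eqI, simp add: lambda_deriv_add lambda_deriv_mult lambda_deriv_sum mcoeff_mult sum.distrib)+
  then show ?thesis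
    by (simp add: pd_def twisted_derivation_mfps_deriv)
qed

interpretation pd: twisted_derivation "\<lambda>f. f" "pd i" for i
  by (rule twisted_derivation_pd)

lemma mfps_map_lambda_deriv_commute:
  "mfps_deriv v (mfps_map lambda_deriv f) = mfps_map lambda_deriv (mfps_deriv v f)"
  by (rule mfps_eqI) (simp add: lambda_deriv_of_nat_mult del: of_nat_Suc)

lemma mfps_deriv_pd: "mfps_deriv v (pd i f) = pd i (mfps_deriv v f)"
  by (simp add: pd_def mfps_map_lambda_deriv_commute mfps_deriv_commute)

lemma pd_commute: "pd i (pd j f) = pd j (pd i f)"
  by (simp add: pd_def mfps_map_lambda_deriv_commute mfps_deriv_commute)

lemma proj_pos_pd: "proj_pos (pd i f) = pd i (proj_pos f)"
proof -
  have "proj_pos (mfps_map lambda_deriv f) = mfps_map lambda_deriv (proj_pos f)"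
    by (rule mfps_eqI) (simp add: proj_pos_def lambda_deriv_pos)
  then show ?thesis by (simp add: pd_def proj_pos_deriv)
qed

section \<open>Vector fields\<close>

definition act :: "(3 \<Rightarrow> 'a::comm_ring_1 ser) \<Rightarrow> 'a ser \<Rightarrow> 'a ser" where
  "act w f = (\<Sum>i\<in>UNIV. w i * pd i f)"

definition bracket :: "(3 \<Rightarrow> 'a::comm_ring_1 ser) \<Rightarrow> (3 \<Rightarrow> 'a ser) \<Rightarrow> 3 \<Rightarrow> 'a ser" where
  "bracket u w i = act u (w i) - act w (u i)"

definition divergence :: "(3 \<Rightarrow> 'a::comm_ring_1 ser) \<Rightarrow> 'a ser" where
  "divergence w = (\<Sum>i\<in>UNIV. pd i (w i))"

lemma twisted_derivation_act: "twisted_derivation (\<lambda>f. f) (act w)"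
  by unfold_locales
    (simp_all add: act_def pd.D_add pd.D_mult algebra_simps sum.distrib sum_distrib_left)

interpretation act: twisted_derivation "\<lambda>f. f" "act w" for w
  by (rule twisted_derivation_act)

lemma act_add_field: "act (\<lambda>i. u i + w i) f = act u f + act w f"
  by (simp add: act_def distrib_right sum.distrib)

lemma act_diff_field: "act (\<lambda>i. u i - w i) f = act u f - act w f"
  by (simp add: act_def left_diff_distrib sum_subtractf)

lemma bracket_swap: "bracket u w i = - bracket w u i"
  by (simp add: bracket_def)

lemma bracket_add_left: "bracket (\<lambda>i. u i + v i) w i = bracket u w i + bracket v w i"
  by (simp add: bracket_def act_add_field act.D_add)

lemma bracket_add_right: "bracket w (\<lambda>i. u i + v i) i = bracket w u i + bracket w v i"
  by (simp add: bracket_def act_add_field act.D_add)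

text \<open>The second-order part is symmetric in \<open>u\<close> and \<open>w\<close>, because the
  \<open>pd i\<close> commute; it therefore drops out of the commutator.\<close>

lemma act_act:
  "act u (act w f) = act (\<lambda>i. act u (w i)) f + (\<Sum>i\<in>UNIV. \<Sum>j\<in>UNIV. u i * w j * pd i (pd j f))"
proof -
  have "act u (act w f) =
      (\<Sum>i\<in>UNIV. \<Sum>j\<in>UNIV. u i * pd i (w j) * pd j f) + (\<Sum>i\<in>UNIV. \<Sum>j\<in>UNIV. u i * w j * pd i (pd j f))"
    by (simp add: act_def pd.D_sum pd.D_mult sum_distrib_left distrib_left sum.distrib mult.assoc)
  also have "(\<Sum>i\<in>UNIV. \<Sum>j\<in>UNIV. u i * pd i (w j) * pd j f) = act (\<lambda>i. act u (w i)) f"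
    unfolding act_def sum_distrib_right by (rule sum.swap)
  finally show ?thesis .
qed

lemma act_bracket: "act (bracket u w) f = act u (act w f) - act w (act u f)"
proof -
  have "(\<Sum>i\<in>UNIV. \<Sum>j\<in>UNIV. u i * w j * pd i (pd j f)) =
      (\<Sum>i\<in>UNIV. \<Sum>j\<in>UNIV. w i * u j * pd i (pd j f))"
    by (subst sum.swap) (simp add: pd_commute mult.commute)
  then show ?thesis
    by (simp add: act_act bracket_def[abs_def] act_diff_field)
qed

lemma pd_act: "pd i (act w f) = act (\<lambda>j. pd i (w j)) f + act w (pd i f)"
  by (simp add: act_def pd.D_sum pd.D_mult sum.distrib pd_commute)

lemma proj_pos_act_pos:
  assumes "\<And>i. proj_pos (w i) = w i" "proj_pos f = f"
  shows "proj_pos (act w f) = act w f"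
  by (simp add: act_def proj_pos_sum proj_pos_mult_pos assms proj_pos_pd)

lemma proj_pos_act_neg:
  assumes "\<And>i. proj_pos (w i) = 0" "proj_pos f = 0"
  shows "proj_pos (act w f) = 0"
  by (simp add: act_def proj_pos_sum proj_pos_mult_neg assms proj_pos_pd pd.D_zero)

text \<open>
  Fields without negative powers and fields without nonnegative powers form Lie subalgebras; expand
  \<open>[w\<^sub>+ + w\<^sub>-, u\<^sub>+ + u\<^sub>-] = 0\<close> and project.
\<close>

lemma proj_pos_bracket_commuting:
  fixes u w :: "3 \<Rightarrow> 'a::comm_ring_1 ser"
  assumes "\<And>i. bracket w u i = 0"
  shows "proj_pos (bracket (\<lambda>i. proj_pos (w i)) u i) - proj_pos (bracket (\<lambda>i. proj_pos (u i)) w i) =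
         bracket (\<lambda>i. proj_pos (w i)) (\<lambda>i. proj_pos (u i)) i"
proof -
  define up un wp wn where defs: "up = (\<lambda>i. proj_pos (u i))" "un = (\<lambda>i. u i - proj_pos (u i))"
    "wp = (\<lambda>i. proj_pos (w i))" "wn = (\<lambda>i. w i - proj_pos (w i))"
  have u: "u = (\<lambda>i. up i + un i)" and w: "w = (\<lambda>i. wp i + wn i)"
    by (simp_all add: defs)
  have pos: "proj_pos (bracket wp up i) = bracket wp up i"
    by (simp add: bracket_def proj_pos_diff proj_pos_act_pos defs)
  have neg: "proj_pos (bracket wn un i) = 0"
    by (simp add: bracket_def proj_pos_diff proj_pos_act_neg defs)
  have "proj_pos (bracket w u i) = bracket wp up i + proj_pos (bracket wp un i)
      + proj_pos (bracket wn up i)"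
    by (simp add: u w bracket_add_left bracket_add_right proj_pos_add pos neg)
  then have 0: "bracket wp up i + proj_pos (bracket wp un i) + proj_pos (bracket wn up i) = 0"
    by (simp add: assms)
  have minus: "proj_pos (- f) = - proj_pos f" for f :: "'a ser"
    using proj_pos_diff[of 0 f] by simp
  have "proj_pos (bracket wp u i) - proj_pos (bracket up w i) =
      (bracket wp up i + proj_pos (bracket wp un i)) - (- bracket wp up i - proj_pos (bracket wn up i))"
    unfolding bracket_swap[of up] minus by (simp add: u w bracket_add_left bracket_add_right proj_pos_add pos)
  \<comment> \<open>The line above contains \<open>bracket wp up i\<close> twice together with both
    mixed projections; by \<open>0\<close> the mixed ones cancel one copy.\<close>
  also have "\<dots> = bracket wp up i"
    using 0 by (simp add: algebra_simps)
  finally show ?thesis by (simp add: defs)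
qed

section \<open>The flows\<close>

definition V_full :: "3 \<Rightarrow> nat \<Rightarrow> 'a::comm_ring_1 ser ^ 3 \<Rightarrow> 3 \<Rightarrow> 'a ser" where
  "V_full a n \<Psi> i = matrix_inv (Jac \<Psi>) $ a $ i * (\<Psi> $ 0) ^ n"

lemma V_pos_eq: "V_pos a n \<Psi> = (\<lambda>i. proj_pos (V_full a n \<Psi> i))"
  by (simp add: V_pos_def[abs_def] V_full_def)

lemma flow_nth: "flow a n \<Psi> $ k = act (V_pos a n \<Psi>) (\<Psi> $ k)"
  by (simp add: flow_def act_def)

lemma Jac_nth: "Jac \<Psi> $ i $ k = pd i (\<Psi> $ k)"
  by (simp add: Jac_def)

context
  fixes \<Psi> :: "'a::comm_ring_1 ser ^ 3"
  assumes inv: "invertible (Jac \<Psi>)"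
begin

lemma inverse_Jac_sum:
  "(\<Sum>i\<in>UNIV. matrix_inv (Jac \<Psi>) $ a $ i * pd i (\<Psi> $ k)) = (if a = k then 1 else 0)"
  "(\<Sum>k\<in>UNIV. pd i (\<Psi> $ k) * matrix_inv (Jac \<Psi>) $ k $ j) = (if i = j then 1 else 0)"
  using arg_cong[OF matrix_inv_mult(2)[OF inv], of "\<lambda>A. A $ a $ k"]
    arg_cong[OF matrix_inv_mult(1)[OF inv], of "\<lambda>A. A $ i $ j"]
  by (simp_all add: matrix_matrix_mult_def Jac_nth mat_def)

lemma act_V_full: "act (V_full a n \<Psi>) (\<Psi> $ k) = (if a = k then (\<Psi> $ 0) ^ n else 0)"
proof -
  have "act (V_full a n \<Psi>) (\<Psi> $ k) =
     (\<Sum>i\<in>UNIV. matrix_inv (Jac \<Psi>) $ a $ i * pd i (\<Psi> $ k)) * (\<Psi> $ 0) ^ n"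
    by (simp add: act_def V_full_def sum_distrib_left sum_distrib_right mult_ac)
  then show ?thesis by (simp add: inverse_Jac_sum)
qed

text \<open>The components of \<open>\<Psi>\<close> serve as coordinates: the inverse Jacobi matrix
  recovers a field from its values on them. Identities between fields are proved below by this
  comparison.\<close>

lemma field_eqI:
  assumes "\<And>k. act u (\<Psi> $ k) = act w (\<Psi> $ k)"
  shows "u = w"
proof
  fix i
  have recover: "u i = (\<Sum>k\<in>UNIV. act u (\<Psi> $ k) * matrix_inv (Jac \<Psi>) $ k $ i)" for u :: "3 \<Rightarrow> 'a ser"
  proof -
    have "(\<Sum>k\<in>UNIV. act u (\<Psi> $ k) * matrix_inv (Jac \<Psi>) $ k $ i) =
        (\<Sum>j\<in>UNIV. u j * (\<Sum>k\<in>UNIV. pd j (\<Psi> $ k) * matrix_inv (Jac \<Psi>) $ k $ i))"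
      unfolding act_def sum_distrib_left sum_distrib_right
      by (subst sum.swap) (simp add: mult.assoc)
    then show ?thesis by (simp add: inverse_Jac_sum if_distrib cong: if_cong)
  qed
  show "u i = w i" by (subst (1 2) recover) (simp add: assms)
qed

text \<open>Each field sends every coordinate to zero or to a power of \<open>\<Psi> $ 0\<close>,
  and the other field annihilates that power because its index is not 0.\<close>

lemma V_full_commute:
  assumes "a \<noteq> 0" "b \<noteq> 0"
  shows "bracket (V_full a n \<Psi>) (V_full b m \<Psi>) = (\<lambda>i. 0)"
proof (rule field_eqI)
  fix k :: 3
  have "act (V_full c l \<Psi>) (if d = k then (\<Psi> $ 0) ^ j else 0) = 0" if "c \<noteq> 0" for c d l j
    using that by (simp add: act.D_power act.D_zero act_V_full)
  then show "act (bracket (V_full a n \<Psi>) (V_full b m \<Psi>)) (\<Psi> $ k) = act (\<lambda>i. 0) (\<Psi> $ k)"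
    unfolding act_bracket act_V_full using assms by (simp add: act_def[of "\<lambda>i. 0"])
qed

lemma act_V_full_det:
  assumes "a \<noteq> 0"
  shows "act (V_full a n \<Psi>) (det (Jac \<Psi>)) = - divergence (V_full a n \<Psi>) * det (Jac \<Psi>)"
proof -
  let ?V = "V_full a n \<Psi>" and ?M = "matrix_inv (Jac \<Psi>)"
  \<comment> \<open>The second term is the commutator of \<open>?V\<close> with \<open>pd i\<close>.
    The first rewrites \<open>pd i (act ?V (\<Psi> $ k))\<close> as a combination of rows of the
    Jacobi matrix, by inserting the inverse matrix.\<close>
  define N where "N i j = (\<Sum>l\<in>UNIV. pd i (act ?V (\<Psi> $ l)) * ?M $ l $ j) - pd i (?V j)" for i j
  have "act ?V (Jac \<Psi> $ i $ k) = (\<Sum>j\<in>UNIV. N i j * Jac \<Psi> $ j $ k)" for i k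
  proof -
    have "(\<Sum>j\<in>UNIV. (\<Sum>l\<in>UNIV. pd i (act ?V (\<Psi> $ l)) * ?M $ l $ j) * pd j (\<Psi> $ k)) =
        (\<Sum>l\<in>UNIV. pd i (act ?V (\<Psi> $ l)) * (\<Sum>j\<in>UNIV. ?M $ l $ j * pd j (\<Psi> $ k)))"
      unfolding sum_distrib_left sum_distrib_right by (subst sum.swap) (simp add: mult.assoc)
    also have "\<dots> = pd i (act ?V (\<Psi> $ k))" by (simp add: inverse_Jac_sum if_distrib cong: if_cong)
    finally show ?thesis
      by (simp add: Jac_nth N_def left_diff_distrib sum_subtractf pd_act) (simp add: act_def)
  qed
  then have "act ?V (det (Jac \<Psi>)) = (\<Sum>i\<in>UNIV. N i i) * det (Jac \<Psi>)"
    by (rule act.D_det)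
  \<comment> \<open>The first term of \<open>N\<close> has as its trace the coordinate field
    \<open>V_full a 0\<close> applied to a power of \<open>\<Psi> $ 0\<close>, which is zero for
    \<open>a \<noteq> 0\<close>.\<close>
  also have "(\<Sum>i\<in>UNIV. N i i) = - divergence ?V"
  proof -
    have "(\<Sum>l\<in>UNIV. pd i (act ?V (\<Psi> $ l)) * ?M $ l $ i) = pd i ((\<Psi> $ 0) ^ n) * ?M $ a $ i" for i
      by (simp add: act_V_full if_distrib[of "pd i"] if_distrib[of "\<lambda>x. x * _"] pd.D_zero cong: if_cong)
    then have "(\<Sum>i\<in>UNIV. \<Sum>l\<in>UNIV. pd i (act ?V (\<Psi> $ l)) * ?M $ l $ i) = act (V_full a 0 \<Psi>) ((\<Psi> $ 0) ^ n)"
      by (simp add: act_def[of "V_full a 0 \<Psi>"] V_full_def mult.commute)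
    also have "\<dots> = 0" using assms by (simp add: act.D_power act_V_full)
    finally show ?thesis by (simp add: N_def divergence_def sum_subtractf)
  qed
  finally show ?thesis .
qed

end

lemma divergence_V_pos: "divergence (V_pos a n \<Psi>) = proj_pos (divergence (V_full a n \<Psi>))"
  by (simp add: divergence_def V_pos_eq proj_pos_sum proj_pos_pd)

text \<open>
  \<open>D - v\<close> is a derivation along \<open>E\<close> that kills \<open>\<Psi>\<close>, so its values on the Jacobi matrix come from
  the commutators \<open>[\<partial>\<^sub>i, v]\<close> only.
\<close>

lemma det_Jac_evolution:
  fixes \<Psi> :: "'a::comm_ring_1 ser ^ 3"
  assumes tw: "twisted_derivation E D"
    and E: "\<And>i f. E (pd i f) = pd i (E f)" and D: "\<And>i f. D (pd i f) = pd i (D f)"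
    and ev: "\<And>k. D (\<Psi> $ k) = act v (E (\<Psi> $ k))"
  shows "D (det (Jac \<Psi>)) = act v (E (det (Jac \<Psi>))) + divergence v * E (det (Jac \<Psi>))"
proof -
  interpret twisted_derivation E D by (rule tw)
  interpret twisted_derivation E "\<lambda>f. D f - act v (E f)"
    by unfold_locales
      (simp_all add: E_one E_add E_mult D_add D_mult act.D_add act.D_mult algebra_simps)
  have "D (det (Jac \<Psi>)) - act v (E (det (Jac \<Psi>))) = (\<Sum>i\<in>UNIV. pd i (v i)) * E (det (Jac \<Psi>))"
    by (rule D_det) (simp add: Jac_nth D E ev pd_act, simp add: act_def)
  then show ?thesis by (simp add: divergence_def algebra_simps)
qed

section \<open>Commutativity and the determinant\<close>

interpretation eps: twisted_derivation "mfps_at_zero {Eps}"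
  "\<lambda>f :: 'a::comm_ring_1 ser. mfps_at_zero {Eps} (mfps_deriv Eps f)"
  by (rule twisted_derivation_at_zero)

lemma time_neq_Eps [simp]: "time a n \<noteq> Eps" "Eps \<noteq> time a n"
  by (simp_all add: time_def)

lemma mfps_at_zero_deriv:
  assumes "v \<notin> S"
  shows "mfps_at_zero S (mfps_deriv v f) = mfps_deriv v (mfps_at_zero S f)"
  using assms by (intro mfps_eqI) (simp add: mcoeff_at_zero)

lemma mfps_at_zero_pd:
  fixes f :: "'a::comm_ring_1 ser"
  assumes "time 1 0 \<notin> S" "time 2 0 \<notin> S"
  shows "mfps_at_zero S (pd i f) = pd i (mfps_at_zero S f)"
proof -
  have "mfps_at_zero S (mfps_map lambda_deriv f) = mfps_map lambda_deriv (mfps_at_zero S f)"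
    by (rule mfps_eqI) (simp add: mcoeff_at_zero)
  then show ?thesis using assms by (simp add: pd_def mfps_at_zero_deriv)
qed

lemma eps_E_pd: "mfps_at_zero {Eps} (pd i f) = pd i (mfps_at_zero {Eps} f)"
  by (simp add: mfps_at_zero_pd)

lemma eps_D_pd:
  "mfps_at_zero {Eps} (mfps_deriv Eps (pd i f)) = pd i (mfps_at_zero {Eps} (mfps_deriv Eps f))"
  by (simp add: mfps_deriv_pd eps_E_pd)

lemma eps_E_act:
  "mfps_at_zero {Eps} (act w f) = act (\<lambda>i. mfps_at_zero {Eps} (w i)) (mfps_at_zero {Eps} f)"
  by (simp add: act_def eps.E_sum eps.E_mult eps_E_pd)

lemma eps_D_act:
  "mfps_at_zero {Eps} (mfps_deriv Eps (act w f)) =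
     act (\<lambda>i. mfps_at_zero {Eps} (mfps_deriv Eps (w i))) (mfps_at_zero {Eps} f) +
     act (\<lambda>i. mfps_at_zero {Eps} (w i)) (mfps_at_zero {Eps} (mfps_deriv Eps f))"
  by (simp only: act_def eps.D_sum eps.D_mult eps_E_pd eps_D_pd sum.distrib)

lemma invertible_Jac:
  fixes \<Psi> :: "'a::field ser ^ 3"
  assumes "mcoeff (det (Jac \<Psi>)) {#} \<noteq> 0"
  shows "invertible (Jac \<Psi>)"
  using mfps_unit[OF assms] invertible_if_det_unit_3 by metis

text \<open>The condition on the constant term gives an invertible Jacobi matrix and persists under
  perturbation, since adding a multiple of \<open>mfps_var Eps\<close> leaves the constant term of
  the determinant unchanged.\<close>

locale nondegenerate =
  fixes \<Psi> :: "'a::field ser ^ 3"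
  assumes nondeg: "mcoeff (det (Jac \<Psi>)) {#} \<noteq> 0"
    and eps_free_\<Psi>: "mfps_at_zero {Eps} (\<Psi> $ k) = \<Psi> $ k"
begin

lemmas inv = invertible_Jac[OF nondeg]

definition moved :: "'a ser ^ 3 \<Rightarrow> 'a ser ^ 3" where
  "moved \<Phi> = (\<chi> k. \<Psi> $ k + mfps_var Eps * \<Phi> $ k)"

lemma eps_E_moved: "mfps_at_zero {Eps} (moved \<Phi> $ k) = \<Psi> $ k"
proof -
  have "mfps_at_zero {Eps} (mfps_var Eps :: 'a ser) = 0"
    by (rule mfps_eqI) (simp add: mcoeff_at_zero mcoeff_var)
  then show ?thesis by (simp add: moved_def eps.E_add eps.E_mult eps_free_\<Psi>)
qed

lemma eps_D_moved:
  assumes "mfps_at_zero {Eps} (\<Phi> $ k) = \<Phi> $ k"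
  shows "mfps_at_zero {Eps} (mfps_deriv Eps (moved \<Phi> $ k)) = \<Phi> $ k"
proof -
  have "mfps_deriv Eps f = 0" if "mfps_at_zero {Eps} f = f" for f :: "'a ser"
  proof (rule mfps_eqI)
    fix m
    show "mcoeff (mfps_deriv Eps f) m = mcoeff 0 m"
      using that[THEN arg_cong[of _ _ "\<lambda>f. mcoeff f (add_mset Eps m)"]]
      by (simp add: mcoeff_at_zero)
  qed
  moreover have "mfps_at_zero {Eps} (mfps_deriv Eps (mfps_var Eps :: 'a ser)) = 1"
    by (rule mfps_eqI) (auto simp: mcoeff_at_zero mcoeff_var mcoeff_one)
  ultimately show ?thesis
    by (simp add: moved_def mfps_deriv_add mfps_deriv_mult eps.E_add eps.E_mult assms
        eps_free_\<Psi> eps.E_zero)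
qed

lemma eps_E_det_moved: "mfps_at_zero {Eps} (det (Jac (moved \<Phi>))) = det (Jac \<Psi>)"
  by (simp add: eps.E_det Jac_nth eps_E_pd eps_E_moved) (simp add: Jac_def)

lemma inv_moved: "invertible (Jac (moved \<Phi>))"
proof (rule invertible_Jac)
  have "mcoeff (det (Jac (moved \<Phi>))) {#} = mcoeff (mfps_at_zero {Eps} (det (Jac (moved \<Phi>)))) {#}"
    by (simp add: mcoeff_at_zero)
  then show "mcoeff (det (Jac (moved \<Phi>))) {#} \<noteq> 0"
    using nondeg by (simp add: eps_E_det_moved)
qed

text \<open>The inverse matrix is accessible only through its defining equations, so evaluation at
  \<open>Eps\<close> = 0 is carried through the values of the fields on the coordinates.\<close>

lemma eps_E_V_full: "(\<lambda>i. mfps_at_zero {Eps} (V_full a n (moved \<Phi>) i)) = V_full a n \<Psi>"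
proof (rule field_eqI[OF inv])
  fix k :: 3
  show "act (\<lambda>i. mfps_at_zero {Eps} (V_full a n (moved \<Phi>) i)) (\<Psi> $ k) = act (V_full a n \<Psi>) (\<Psi> $ k)"
    using arg_cong[OF act_V_full[OF inv_moved, of a n \<Phi> k], of "mfps_at_zero {Eps}"]
    by (simp add: eps_E_act eps_E_moved act_V_full[OF inv] eps.E_power eps.E_zero split: if_splits)
qed

lemma eps_E_V_pos: "(\<lambda>i. mfps_at_zero {Eps} (V_pos a n (moved \<Phi>) i)) = V_pos a n \<Psi>"
  using fun_cong[OF eps_E_V_full[of a n \<Phi>]] by (simp add: V_pos_eq flip: proj_pos_at_zero)

text \<open>The Lax equation, for an arbitrary field \<open>u\<close> driving the perturbation: the
  relation \<open>act_V_full\<close> for the moved triple is differentiated at \<open>Eps\<close> =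
  0.\<close>

lemma eps_D_V_full:
  assumes eps_free_\<Phi>: "\<And>k. mfps_at_zero {Eps} (\<Phi> $ k) = \<Phi> $ k"
    and \<Phi>: "\<And>k. \<Phi> $ k = act u (\<Psi> $ k)"
  shows "(\<lambda>i. mfps_at_zero {Eps} (mfps_deriv Eps (V_full a n (moved \<Phi>) i))) = bracket u (V_full a n \<Psi>)"
proof (rule field_eqI[OF inv])
  fix k :: 3
  let ?D = "\<lambda>f. mfps_at_zero {Eps} (mfps_deriv Eps f)"
  have "act (\<lambda>i. ?D (V_full a n (moved \<Phi>) i)) (\<Psi> $ k) + act (V_full a n \<Psi>) (act u (\<Psi> $ k)) =
      ?D (act (V_full a n (moved \<Phi>)) (moved \<Phi> $ k))"
    by (simp add: eps_D_act eps_E_moved eps_E_V_full eps_D_moved eps_free_\<Phi> flip: \<Phi>)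
  also have "\<dots> = ?D (if a = k then (moved \<Phi> $ 0) ^ n else 0)"
    by (simp add: act_V_full[OF inv_moved])
  also have "\<dots> = (if a = k then of_nat n * (\<Psi> $ 0) ^ (n - 1) * act u (\<Psi> $ 0) else 0)"
    by (simp add: eps.D_power eps.D_zero eps_E_moved eps_D_moved eps_free_\<Phi> flip: \<Phi>)
  \<comment> \<open>The right-hand side is built from \<open>\<Psi> $ 0\<close> alone, so its
    variation is \<open>u\<close> applied to it.\<close>
  also have "\<dots> = act u (act (V_full a n \<Psi>) (\<Psi> $ k))"
    by (simp add: act_V_full[OF inv] act.D_power act.D_zero)
  finally show "act (\<lambda>i. ?D (V_full a n (moved \<Phi>) i)) (\<Psi> $ k) = act (bracket u (V_full a n \<Psi>)) (\<Psi> $ k)"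
    by (simp add: act_bracket algebra_simps)
qed

lemma eps_free_flow: "mfps_at_zero {Eps} (flow a n \<Psi> $ k) = flow a n \<Psi> $ k"
proof -
  \<comment> \<open>With the zero perturbation, \<open>eps_E_V_pos\<close> says that the projected
    field itself is free of \<open>Eps\<close>.\<close>
  have "moved 0 = \<Psi>" by (simp add: moved_def vec_eq_iff)
  then show ?thesis
    using eps_E_V_pos[of a n 0] by (simp add: flow_nth eps_E_act eps_free_\<Psi>)
qed

text \<open>Product rule: the field varies by the projected Lax equation, its argument by the
  flow.\<close>

lemma time_deriv_flow:
  "time_deriv b m (\<lambda>\<Psi>. flow a n \<Psi> $ k) \<Psi> =
     act (\<lambda>i. proj_pos (bracket (V_pos b m \<Psi>) (V_full a n \<Psi>) i)) (\<Psi> $ k) +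
     act (V_pos a n \<Psi>) (act (V_pos b m \<Psi>) (\<Psi> $ k))"
proof -
  let ?\<Phi> = "flow b m \<Psi>"
  let ?D = "\<lambda>f :: 'a ser. mfps_at_zero {Eps} (mfps_deriv Eps f)"
  have "?D (V_pos a n (moved ?\<Phi>) i) = proj_pos (bracket (V_pos b m \<Psi>) (V_full a n \<Psi>) i)" for i
    using fun_cong[OF eps_D_V_full[OF eps_free_flow flow_nth, of a n b m], of i]
    by (simp add: V_pos_eq flip: proj_pos_at_zero proj_pos_deriv)
  then have "?D (act (V_pos a n (moved ?\<Phi>)) (moved ?\<Phi> $ k)) =
     act (\<lambda>i. proj_pos (bracket (V_pos b m \<Psi>) (V_full a n \<Psi>) i)) (\<Psi> $ k) +
     act (V_pos a n \<Psi>) (act (V_pos b m \<Psi>) (\<Psi> $ k))"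
    by (simp add: eps_D_act eps_E_moved eps_E_V_pos eps_D_moved eps_free_flow) (simp add: flow_nth)
  then show ?thesis
    by (simp only: time_deriv_def variation_def moved_def[symmetric] flow_nth[of a n "moved _"])
qed

lemma flows_commute:
  assumes "a \<noteq> 0" "b \<noteq> 0"
  shows "time_deriv b m (\<lambda>\<Psi>. flow a n \<Psi> $ k) \<Psi> = time_deriv a n (\<lambda>\<Psi>. flow b m \<Psi> $ k) \<Psi>"
proof -
  let ?u = "V_full a n \<Psi>" and ?w = "V_full b m \<Psi>"
  have "bracket ?w ?u i = 0" for i
    using V_full_commute[OF inv assms(2,1)] by simp
  note proj_pos_bracket_commuting[OF this]
  then have "(\<lambda>i. proj_pos (bracket (V_pos b m \<Psi>) ?u i) - proj_pos (bracket (V_pos a n \<Psi>) ?w i)) =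
      bracket (V_pos b m \<Psi>) (V_pos a n \<Psi>)"
    by (simp add: V_pos_eq)
  \<comment> \<open>The first terms of the two instances of \<open>time_deriv_flow\<close> differ by
    the commutator of the projected fields; this cancels the difference of the second terms, which
    are its two compositions in opposite order.\<close>
  from arg_cong[OF this, of "\<lambda>v. act v (\<Psi> $ k)"] show ?thesis
    by (simp add: time_deriv_flow act_diff_field act_bracket algebra_simps)
qed

lemma time_deriv_det:
  "time_deriv a n (\<lambda>\<Psi>. det (Jac \<Psi>)) \<Psi> =
     act (V_pos a n \<Psi>) (det (Jac \<Psi>)) + divergence (V_pos a n \<Psi>) * det (Jac \<Psi>)"
proof -
  have "mfps_at_zero {Eps} (mfps_deriv Eps (det (Jac (moved (flow a n \<Psi>))))) =
     act (V_pos a n \<Psi>) (mfps_at_zero {Eps} (det (Jac (moved (flow a n \<Psi>))))) +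
     divergence (V_pos a n \<Psi>) * mfps_at_zero {Eps} (det (Jac (moved (flow a n \<Psi>))))"
    by (rule det_Jac_evolution[OF twisted_derivation_at_zero eps_E_pd eps_D_pd])
      (simp add: eps_E_moved eps_D_moved eps_free_flow, simp add: flow_nth)
  then show ?thesis
    by (simp add: time_deriv_def variation_def eps_E_det_moved flip: moved_def)
qed

text \<open>When the determinant is 1, \<open>act_V_full_det\<close> forces the unprojected
  divergence to vanish, hence also its projection.\<close>

lemma time_deriv_det_eq_0:
  assumes "a \<noteq> 0" "det (Jac \<Psi>) = 1"
  shows "time_deriv a n (\<lambda>\<Psi>. det (Jac \<Psi>)) \<Psi> = 0"
  using act_V_full_det[OF inv assms(1), of n]
  by (simp add: time_deriv_det assms(2) act.D_one divergence_V_pos)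

end

section \<open>Uniqueness for the evolution of the determinant\<close>

text \<open>A filtration by the degree in the variables of \<open>T\<close> only. Multiplication,
  projection and derivatives in variables outside \<open>T\<close> respect it, while a derivative in
  a variable of \<open>T\<close> lowers the degree by one.\<close>

definition vanishes_below :: "'v set \<Rightarrow> nat \<Rightarrow> ('v, 'a::zero) mfps \<Rightarrow> bool" where
  "vanishes_below T s f \<longleftrightarrow> (\<forall>m. size {#v \<in># m. v \<in> T#} < s \<longrightarrow> mcoeff f m = 0)"

lemma vanishes_below_add:
  "vanishes_below T s f \<Longrightarrow> vanishes_below T s g \<Longrightarrow> vanishes_below T s (f + (g :: ('v, 'a::comm_ring_1) mfps))"
  by (simp add: vanishes_below_def)

lemma vanishes_below_uminus:
  "vanishes_below T s f \<Longrightarrow> vanishes_below T s (- (f :: ('v, 'a::comm_ring_1) mfps))"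
  by (simp add: vanishes_below_def)

lemma vanishes_below_sum:
  "(\<And>x. x \<in> A \<Longrightarrow> vanishes_below T s (f x :: ('v, 'a::comm_ring_1) mfps)) \<Longrightarrow> vanishes_below T s (sum f A)"
  by (simp add: vanishes_below_def mcoeff_sum)

lemma vanishes_below_mult:
  fixes f g :: "('v, 'a::comm_ring_1) mfps"
  assumes "vanishes_below T s f"
  shows "vanishes_below T s (f * g)" "vanishes_below T s (g * f)"
proof -
  show "vanishes_below T s (f * g)"
    unfolding vanishes_below_def
  proof safe
    fix m assume m: "size {#v \<in># m. v \<in> T#} < s"
    have "mcoeff f p = 0" if "p \<subseteq># m" for p
      using assms m size_mset_mono[OF multiset_filter_mono[OF that, of "\<lambda>v. v \<in> T"]]
      by (auto simp: vanishes_below_def)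
    then show "mcoeff (f * g) m = 0"
      by (simp add: mcoeff_mult)
  qed
  then show "vanishes_below T s (g * f)" by (simp add: mult.commute)
qed

lemma vanishes_below_proj_pos: "vanishes_below T s f \<Longrightarrow> vanishes_below T s (proj_pos f)"
  by (simp add: vanishes_below_def proj_pos_def)

lemma vanishes_below_act:
  fixes f :: "'a::comm_ring_1 ser"
  assumes "time 1 0 \<notin> T" "time 2 0 \<notin> T" "vanishes_below T s f"
  shows "vanishes_below T s (act w f)"
  unfolding act_def
  by (intro vanishes_below_sum vanishes_below_mult(2))
    (use assms in \<open>simp add: vanishes_below_def pd_def\<close>)

text \<open>
  Along an actual solution \<open>e = det J - 1\<close> obeys a homogeneous linear evolution equation, so all of
  its Taylor coefficients in the times are determined by the vanishing initial value.
\<close>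

lemma det_Jac_eq_1:
  fixes \<Psi> :: "'a::field_char_0 ser ^ 3"
  assumes nondeg: "mcoeff (det (Jac \<Psi>)) {#} \<noteq> 0"
    and S: "S \<subseteq> {1, 2} \<times> {1..}"
    and sol: "\<And>a n. (a, n) \<in> S \<Longrightarrow> solves_flow a n \<Psi>"
    and init: "mfps_at_zero {time a n | a n. (a, n) \<in> S} (det (Jac \<Psi>)) = 1"
  shows "det (Jac \<Psi>) = 1"
proof -
  define T where "T = {time a n | a n. (a, n) \<in> S}"
  \<comment> \<open>The index 0 is excluded from \<open>S\<close> because these times are x and y,
    in which the right-hand side of the evolution is itself differentiated.\<close>
  have T: "time 1 0 \<notin> T" "time 2 0 \<notin> T"
    using S by (auto simp: T_def time_def split: if_splits)
  define d where "d = det (Jac \<Psi>)"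
  obtain d' where d': "d * d' = 1"
    using mfps_unit[OF nondeg] unfolding d_def by blast
  define e where "e = d - 1"
  note inv = invertible_Jac[OF nondeg]
  \<comment> \<open>The divergence is eliminated by means of \<open>act_V_full_det\<close>; since
    derivations kill constants, \<open>d\<close> may be replaced by \<open>e\<close> under them,
    which makes the equation homogeneous in \<open>e\<close>.\<close>
  have deriv: "mfps_deriv (time a n) e =
      act (V_pos a n \<Psi>) e + proj_pos (- act (V_full a n \<Psi>) e * d') * d" if "(a, n) \<in> S" for a n
  proof -
    from that S have "a \<noteq> 0" by auto
    have "mfps_deriv (time a n) d = act (V_pos a n \<Psi>) d + divergence (V_pos a n \<Psi>) * d"
      unfolding d_def
      by (rule det_Jac_evolution[OF twisted_derivation_mfps_deriv _ mfps_deriv_pd])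
        (use sol[OF that] in \<open>simp_all add: solves_flow_def flow_nth\<close>)
    also have "act (V_full a n \<Psi>) d * d' = - divergence (V_full a n \<Psi>) * (d * d')"
      using act_V_full_det[OF inv \<open>a \<noteq> 0\<close>, of n] by (simp add: d_def mult_ac)
    then have "divergence (V_full a n \<Psi>) = - act (V_full a n \<Psi>) d * d'"
      by (simp add: d')
    then have "divergence (V_pos a n \<Psi>) = proj_pos (- act (V_full a n \<Psi>) d * d')"
      by (simp add: divergence_V_pos)
    also have "act w d = act w e" for w
      by (simp add: e_def act.D_diff act.D_one)
    moreover have "mfps_deriv (time a n) e = mfps_deriv (time a n) d"
      using twisted_derivation.D_diff[OF twisted_derivation_mfps_deriv, of "time a n" d 1]
        twisted_derivation.D_one[OF twisted_derivation_mfps_deriv, of "time a n"]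
      by (simp add: e_def)
    ultimately show ?thesis by simp
  qed
  have "vanishes_below T s e" for s
  proof (induction s)
    case 0
    show ?case by (simp add: vanishes_below_def)
  next
    case (Suc s)
    show ?case
      unfolding vanishes_below_def
    proof safe
      fix m assume m: "size {#v \<in># m. v \<in> T#} < Suc s"
      show "mcoeff e m = 0"
      proof (cases "set_mset m \<inter> T = {}")
        case True
        then show ?thesis
          using arg_cong[OF init, of "\<lambda>f. mcoeff f m"]
          by (simp add: mcoeff_at_zero e_def d_def flip: T_def)
      next
        case False
        then obtain a n where an: "(a, n) \<in> S" "time a n \<in># m" "time a n \<in> T"
          by (auto simp: T_def)
        from an(2) obtain m' where m': "m = add_mset (time a n) m'"
          by (meson multi_member_split)
        \<comment> \<open>The evolution equation expresses this derivative by operations on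
          \<open>e\<close> that preserve the filtration, so the induction hypothesis applies;
          \<open>m'\<close> has degree below \<open>s\<close> in \<open>T\<close>.\<close>
        have "vanishes_below T s (mfps_deriv (time a n) e)"
          unfolding deriv[OF an(1)]
          by (intro vanishes_below_add vanishes_below_mult(1) vanishes_below_proj_pos
              vanishes_below_uminus vanishes_below_act T Suc.IH)
        then have "mcoeff (mfps_deriv (time a n) e) m' = 0"
          using m an(3) unfolding vanishes_below_def by (simp add: m' del: mcoeff_deriv)
        \<comment> \<open>Characteristic 0 allows division by the multiplicity.\<close>
        then show ?thesis by (simp add: m' del: of_nat_Suc)
      qed
    qed
  qed
  then have "mcoeff e m = 0" for m
    unfolding vanishes_below_def by blast
  then have "e = 0" by (intro mfps_eqI) simp
  then show ?thesis by (simp add: e_def d_def)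
qed

section \<open>The series of the hierarchy\<close>

text \<open>In the adic metric, a partial sum closer to \<open>s\<close> than 2 to the power -|j|
  differs from it by a series of subdegree above |j|, so it already has the right coefficient at
  \<open>j\<close>.\<close>

lemma fls_sums_nth:
  fixes f :: "nat \<Rightarrow> 'a::comm_ring_1 fls"
  assumes "f sums s"
  obtains N where "fls_nth s j = (\<Sum>n<N. fls_nth (f n) j)"
proof -
  have "eventually (\<lambda>N. dist (\<Sum>n<N. f n) s < inverse (2 ^ nat \<bar>j\<bar>)) sequentially"
    using assms unfolding sums_def by (rule tendstoD) simp
  then obtain N where N: "dist (\<Sum>n<N. f n) s < inverse (2 ^ nat \<bar>j\<bar>)"
    unfolding eventually_sequentially by blast
  define u where "u = (\<Sum>n<N. f n) - s"
  have "fls_nth u j = 0"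
  proof (cases "u = 0")
    case False
    then have dist: "dist (\<Sum>n<N. f n) s =
        (if fls_subdegree u \<ge> 0 then inverse (2 ^ nat (fls_subdegree u)) else 2 ^ nat (- fls_subdegree u))"
      by (simp add: dist_fls_def u_def)
    have sub: "fls_subdegree u \<ge> 0"
    proof (rule ccontr)
      assume "\<not> fls_subdegree u \<ge> 0"
      with N dist have "(2 :: real) ^ nat (- fls_subdegree u) < inverse (2 ^ nat \<bar>j\<bar>)" by simp
      moreover have "inverse (2 ^ nat \<bar>j\<bar>) \<le> (1 :: real)" by (simp add: inverse_le_1_iff)
      moreover have "(1 :: real) \<le> 2 ^ nat (- fls_subdegree u)" by (rule one_le_power) simp
      ultimately show False by linarith
    qed
    have "(2 :: real) ^ nat \<bar>j\<bar> < 2 ^ nat (fls_subdegree u)"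
      using N sub unfolding dist by simp
    then have "\<bar>j\<bar> < fls_subdegree u"
      by simp
    then have "j < fls_subdegree u" by linarith
    then show ?thesis by (rule fls_eq0_below_subdegree)
  qed simp
  moreover have "fls_nth (\<Sum>n<N. f n) j = (\<Sum>n<N. fls_nth (f n) j)"
    by (induction N) simp_all
  ultimately show ?thesis
    by (intro that[of N]) (simp add: u_def)
qed

lemma lambda_pos_sums_0:
  fixes f :: "nat \<Rightarrow> 'a::comm_ring_1 fls"
  assumes "f sums s" "\<And>n. lambda_pos (f n) = 0"
  shows "lambda_pos s = 0"
  unfolding lambda_pos_eq_0_iff
proof safe
  fix j :: int assume "j \<le> 0"
  obtain N where "fls_nth s j = (\<Sum>n<N. fls_nth (f n) j)"
    by (rule fls_sums_nth[OF assms(1)])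
  then show "fls_nth s j = 0"
    using assms(2) \<open>j \<le> 0\<close> by (simp add: lambda_pos_eq_0_iff)
qed

lemma mcoeff_mult_single:
  fixes f g :: "('v, 'a::comm_ring_1) mfps"
  shows "mcoeff (f * g) {#v#} = mcoeff f {#v#} * mcoeff g {#} + mcoeff f {#} * mcoeff g {#v#}"
  using arg_cong[OF mfps_deriv_mult[of v f g], of "\<lambda>f. mcoeff f {#}"] by simp

text \<open>Invertibility of \<open>J\<close> depends only on the Taylor coefficients of \<open>\<Psi>\<close> of order at most one in the times.\<close>

definition negative_jet :: "'a::comm_ring_1 ser \<Rightarrow> bool" where
  "negative_jet f \<longleftrightarrow> lambda_pos (mcoeff f {#}) = 0 \<and> (\<forall>v. lambda_pos (mcoeff f {#v#}) = 0)"

lemma negative_jet_mult: "negative_jet f \<Longrightarrow> negative_jet g \<Longrightarrow> negative_jet (f * g)"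
  by (simp add: negative_jet_def mcoeff_mult_single lambda_pos_add lambda_pos_mult_neg)

lemma negative_jet_power: "negative_jet f \<Longrightarrow> negative_jet (f ^ Suc n)"
  by (induction n) (simp_all add: negative_jet_mult)

lemma negative_jet_coef_mult:
  assumes "negative_jet f"
  shows "negative_jet (coef c * f)"
proof -
  have "lambda_pos (fls_const a * u) = 0" if "lambda_pos u = 0" for a :: 'a and u
    using that by (simp add: lambda_pos_eq_0_iff)
  with assms show ?thesis
    by (simp add: negative_jet_def mcoeff_mult_single lambda_pos_add)
qed

lemma negative_jet_sums:
  assumes "f ser_sums s" "\<And>n. negative_jet (f n)"
  shows "negative_jet s"
  using assms lambda_pos_sums_0 unfolding negative_jet_def ser_sums_def by metis

lemma at_zero_sums:
  assumes "f ser_sums s" "\<And>n. mfps_at_zero S (f n) = f n"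
  shows "mfps_at_zero S s = s"
proof (rule mfps_eqI)
  fix m
  show "mcoeff (mfps_at_zero S s) m = mcoeff s m"
  proof (cases "set_mset m \<inter> S = {}")
    case False
    then have "mcoeff (f n) m = 0" for n
      using arg_cong[OF assms(2)[of n], of "\<lambda>f. mcoeff f m"] by (simp add: mcoeff_at_zero)
    moreover have "(\<lambda>n. mcoeff (f n) m) sums mcoeff s m"
      using assms(1) by (simp add: ser_sums_def)
    ultimately have "mcoeff s m = 0"
      using sums_unique2[OF sums_zero] by simp
    then show ?thesis by (simp add: mcoeff_at_zero)
  qed (simp add: mcoeff_at_zero)
qed

lemma lambda_pos_X_power: "lambda_pos (fls_X ^ Suc n :: 'a::comm_ring_1 fls) = 0"
  by (induction n) (simp_all add: lambda_pos_mult_neg lambda_pos_eq_0_iff[of fls_X])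

text \<open>Strictly negative powers of lambda are closed under sums and products, so the
  determinant is 1 plus negative powers and its coefficient at index 0 is 1.\<close>

lemma det_identity_plus_negative:
  fixes B :: "'a::comm_ring_1 fls ^ 3 ^ 3"
  assumes "\<And>i k. lambda_pos (B $ i $ k - (if i = k then 1 else 0)) = 0"
  shows "det B \<noteq> 0"
proof
  assume "det B = 0"
  define b where "b i k = B $ i $ k - (if i = k then 1 else 0)" for i k
  have B: "B $ i $ k = (if i = k then 1 else 0) + b i k" for i k
    by (simp add: b_def)
  have b: "lambda_pos (b i k) = 0" for i k
    using assms by (simp add: b_def)
  have "lambda_pos (det B - 1) = 0"
    by (simp add: det_3 B distrib_left distrib_right lambda_pos_add lambda_pos_diff lambda_pos_uminus
        lambda_pos_mult_neg b)
  then have "lambda_pos (- 1 :: 'a fls) = 0" by (simp add: \<open>det B = 0\<close>)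
  then show False by (auto simp: lambda_pos_eq_0_iff)
qed

lemma at_zero_eqs:
  "eps_free c \<Longrightarrow> mfps_at_zero {Eps} (coef c) = coef c"
  "mfps_at_zero {Eps} (mfps_const u) = mfps_const u"
  "mfps_at_zero {Eps} (mfps_var (time k n)) = mfps_var (time k n)"
  by (rule mfps_eqI, force simp: eps_free_def mcoeff_at_zero mcoeff_const mcoeff_var)+

text \<open>When all times vanish, the Jacobi matrix is the identity plus strictly negative powers
  of lambda. This needs negativity of the jets of the tails, including those in powers of the
  inverse of \<open>\<Psi> $ 0\<close>.\<close>

lemma hierarchy_series_nondegenerate:
  fixes \<Psi> :: "'a::field_char_0 ser ^ 3"
  assumes "hierarchy_series \<Psi>"
  shows "nondegenerate \<Psi>"
proof -
  obtain \<psi> :: "3 \<Rightarrow> nat \<Rightarrow> (var, 'a) mfps" and N0 where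
    free: "\<And>k n. eps_free (\<psi> k n)" and
    N0: "(\<lambda>n. coef (\<psi> 0 (Suc n)) * mfps_const (fls_X ^ Suc n)) ser_sums N0" and
    \<Psi>0: "\<Psi> $ 0 = mfps_const fls_X_inv + N0" and
    \<Psi>k: "\<forall>k \<in> {1, 2}. \<exists>P N.
             (\<lambda>n. mfps_var (time k n) * (\<Psi> $ 0) ^ n) ser_sums P \<and>
             (\<lambda>n. coef (\<psi> k (Suc n)) * mfps_inv (\<Psi> $ 0) ^ Suc n) ser_sums N \<and>
             \<Psi> $ k = P + N"
    using assms unfolding hierarchy_series_def by blast
  have "negative_jet (mfps_const (fls_X ^ Suc n) :: 'a ser)" for n
    unfolding negative_jet_def using lambda_pos_X_power[of n] by (simp add: mcoeff_const)
  then have jet0: "negative_jet N0"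
    by (intro negative_jet_sums[OF N0] negative_jet_coef_mult)
  define u where "u = mcoeff (\<Psi> $ 0) {#}"
  have "fls_nth (mcoeff N0 {#}) j = 0" if "j \<le> 0" for j
    using jet0 that by (simp add: negative_jet_def lambda_pos_eq_0_iff)
  then have "fls_nth u (- 1) = 1" "\<And>j. j < - 1 \<Longrightarrow> fls_nth u j = 0"
    by (simp_all add: u_def \<Psi>0 mcoeff_const)
  then have u: "fls_subdegree u = - 1" "u \<noteq> 0"
    by (auto intro!: fls_subdegree_eqI)
  define g where "g = mfps_inv (\<Psi> $ 0)"
  have g: "\<Psi> $ 0 * g = 1"
    using mfps_unit[of "\<Psi> $ 0"] u(2) mult_mfps_inv unfolding u_def g_def by metis
  define w where "w = mcoeff g {#}"
  have uw: "u * w = 1"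
    using arg_cong[OF g, of "\<lambda>f. mcoeff f {#}"] by (simp add: u_def w_def mcoeff_one)
  then have "w \<noteq> 0" by auto
  \<comment> \<open>The inverse of a series with leading term lambda starts at the inverse of
    lambda.\<close>
  then have "fls_subdegree w = 1"
    using arg_cong[OF uw, of fls_subdegree] u by simp
  then have w: "lambda_pos w = 0"
    by (simp add: lambda_pos_eq_0_iff)
  \<comment> \<open>The usual formula for the derivative of an inverse, read off from the linear
    coefficient of \<open>\<Psi> $ 0 * g = 1\<close>.\<close>
  have "mcoeff g {#v#} = - (w * (mcoeff N0 {#v#} * w))" for v
  proof -
    have "mcoeff N0 {#v#} * w + u * mcoeff g {#v#} = 0"
      using arg_cong[OF g, of "\<lambda>f. mcoeff f {#v#}"]
      by (simp add: mcoeff_mult_single mcoeff_one u_def w_def \<Psi>0 mcoeff_const)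
    then have "w * (mcoeff N0 {#v#} * w) + (u * w) * mcoeff g {#v#} = 0"
      by (metis distrib_left mult.assoc mult.commute mult_zero_right)
    then show ?thesis by (simp add: uw add_eq_0_iff)
  qed
  then have jetg: "negative_jet g"
    using jet0 w by (simp add: negative_jet_def w_def lambda_pos_mult_neg lambda_pos_uminus)

  have eps0: "mfps_at_zero {Eps} (\<Psi> $ 0) = \<Psi> $ 0"
    using at_zero_sums[OF N0, of "{Eps}"]
    by (simp add: \<Psi>0 eps.E_add eps.E_mult at_zero_eqs free)
  \<comment> \<open>Evaluating \<open>g\<close> at \<open>Eps\<close> = 0 gives another inverse of
    \<open>\<Psi> $ 0\<close>, which must coincide with \<open>g\<close>.\<close>
  have "\<Psi> $ 0 * mfps_at_zero {Eps} g = 1"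
    using arg_cong[OF g, of "mfps_at_zero {Eps}"] by (simp add: eps.E_mult eps.E_one eps0)
  then have epsg: "mfps_at_zero {Eps} g = g"
    by (rule mult_right_inverse_unique) (rule g)

  have k: "mfps_at_zero {Eps} (\<Psi> $ k) = \<Psi> $ k \<and> lambda_pos (mcoeff (\<Psi> $ k) {#}) = 0 \<and>
      (\<forall>j\<in>{1, 2}. lambda_pos (mcoeff (\<Psi> $ k) {#time j 0#} - (if j = k then 1 else 0)) = 0)"
    if k12: "k \<in> {1, 2}" for k
  proof -
    obtain P N where P: "(\<lambda>n. mfps_var (time k n) * (\<Psi> $ 0) ^ n) ser_sums P"
      and N: "(\<lambda>n. coef (\<psi> k (Suc n)) * g ^ Suc n) ser_sums N" and PN: "\<Psi> $ k = P + N"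
      using bspec[OF \<Psi>k k12] unfolding g_def[symmetric] by (elim exE conjE) (rule that)
    have jet: "negative_jet N"
      by (intro negative_jet_sums[OF N] negative_jet_coef_mult negative_jet_power jetg)
    have eps: "mfps_at_zero {Eps} P = P" "mfps_at_zero {Eps} N = N"
      by (rule at_zero_sums[OF P] at_zero_sums[OF N],
          simp add: eps.E_mult eps.E_power at_zero_eqs free eps0 epsg del: power_Suc)+
    have P0: "mcoeff P {#} = 0"
      using P sums_unique2[OF sums_zero] by (auto simp: ser_sums_def mcoeff_var dest!: spec[of _ "{#}"])
    \<comment> \<open>The summand with index \<open>n\<close> starts with the variable
      \<open>time k n\<close>, so only \<open>n = 0\<close> can contribute to the linear coefficient
      at \<open>time j 0\<close>.\<close>
    have P1: "mcoeff P {#time j 0#} = (if j = k then 1 else 0)" if "j \<in> {1, 2}" for j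
    proof -
      have "mcoeff (mfps_var (time k n) * (\<Psi> $ 0) ^ n) {#time j 0#} =
          (if n = 0 then if j = k then 1 else 0 else 0)" for n
        using that k12 by (auto simp: mcoeff_mult_single mcoeff_var time_def)
      moreover have "(\<lambda>n. mcoeff (mfps_var (time k n) * (\<Psi> $ 0) ^ n) {#time j 0#}) sums
          mcoeff P {#time j 0#}"
        using P unfolding ser_sums_def by blast
      ultimately have "(\<lambda>n. if n = 0 then if j = k then 1 else 0 else 0) sums mcoeff P {#time j 0#}"
        by (simp only:)
      from sums_unique2[OF this sums_single] show ?thesis .
    qed
    show ?thesis
      using jet by (auto simp: PN eps.E_add eps P0 P1 negative_jet_def)
  qed
  have deriv_neg: "lambda_pos (lambda_deriv v) = 0" if "lambda_pos v = 0" for v :: "'a fls"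
    using lambda_deriv_pos[of v] that by simp
  have cases_3: "i = 0 \<or> i = 1 \<or> i = 2" for i :: 3
    using exhaust_3[of i] by auto
  have "lambda_pos (mcoeff (Jac \<Psi> $ i $ k) {#} - (if i = k then 1 else 0)) = 0" for i k
  proof (cases "k = 0")
    case True
    have "lambda_deriv fls_X_inv = (1 :: 'a fls)"
      by (auto simp: fls_eq_iff nth_lambda_deriv)
    then show ?thesis
      using jet0 cases_3[of i] True
      by (auto simp: Jac_nth pd_def \<Psi>0 mcoeff_const lambda_deriv_add deriv_neg negative_jet_def)
  next
    case False
    then have "k \<in> {1, 2}" using cases_3[of k] by auto
    from k[OF this] show ?thesis
      using cases_3[of i] False by (auto simp: Jac_nth pd_def deriv_neg)
  qed
  then have "det (\<chi> i k. mcoeff (Jac \<Psi> $ i $ k) {#}) \<noteq> 0"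
    by (intro det_identity_plus_negative) simp
  also have "det (\<chi> i k. mcoeff (Jac \<Psi> $ i $ k) {#}) = mcoeff (det (Jac \<Psi>)) {#}"
    by (simp add: det_3)
  finally have "mcoeff (det (Jac \<Psi>)) {#} \<noteq> 0" .
  moreover have "mfps_at_zero {Eps} (\<Psi> $ k) = \<Psi> $ k" for k
  proof (cases "k = 0")
    case False
    then have "k \<in> {1, 2}" using cases_3[of k] by auto
    from k[OF this] show ?thesis by blast
  qed (simp add: eps0)
  ultimately show ?thesis by unfold_locales
qed

text \<open>Preservation of the determinant is expressed both infinitesimally, on triples satisfying
  the constraint, and for actual solutions of any selection \<open>S\<close> of flows, where setting
  the times of \<open>S\<close> to zero gives the initial value.\<close>

theorem proposition3:
  fixes \<Psi> :: "'a::field_char_0 ser ^ 3"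
  assumes "hierarchy_series \<Psi>"
  shows
    "(\<forall>a \<in> {1, 2}. \<forall>b \<in> {1, 2}. \<forall>n m k.
        time_deriv b m (\<lambda>\<Psi>. flow a n \<Psi> $ k) \<Psi> = time_deriv a n (\<lambda>\<Psi>. flow b m \<Psi> $ k) \<Psi>)
     \<and>
     (det (Jac \<Psi>) = 1 \<longrightarrow>
        (\<forall>a \<in> {1, 2}. \<forall>n. time_deriv a n (\<lambda>\<Psi>. det (Jac \<Psi>)) \<Psi> = 0))
     \<and>
     (\<forall>S \<subseteq> {1, 2} \<times> {1..}.
        (\<forall>(a, n) \<in> S. solves_flow a n \<Psi>) \<longrightarrow>
        mfps_at_zero {time a n | a n. (a, n) \<in> S} (det (Jac \<Psi>)) = 1 \<longrightarrow>
        det (Jac \<Psi>) = 1)"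
proof -
  interpret nondegenerate \<Psi>
    by (rule hierarchy_series_nondegenerate[OF assms])
  have neq_0: "a \<noteq> 0" if "a \<in> {1, 2}" for a :: 3
    using that by auto
  show ?thesis
  proof (intro conjI ballI allI impI)
    fix a b :: 3 and n m k assume "a \<in> {1, 2}" "b \<in> {1, 2}"
    then show "time_deriv b m (\<lambda>\<Psi>. flow a n \<Psi> $ k) \<Psi> = time_deriv a n (\<lambda>\<Psi>. flow b m \<Psi> $ k) \<Psi>"
      by (intro flows_commute neq_0)
  next
    fix a :: 3 and n assume "det (Jac \<Psi>) = 1" "a \<in> {1, 2}"
    then show "time_deriv a n (\<lambda>\<Psi>. det (Jac \<Psi>)) \<Psi> = 0"
      by (intro time_deriv_det_eq_0 neq_0)
  next
    fix S assume "S \<subseteq> {1, 2} \<times> {1..}" "\<forall>(a, n) \<in> S. solves_flow a n \<Psi>"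
      "mfps_at_zero {time a n | a n. (a, n) \<in> S} (det (Jac \<Psi>)) = 1"
    then show "det (Jac \<Psi>) = 1"
      by (intro det_Jac_eq_1[OF nondeg]) auto
  qed
qed

end
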